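(* Let $X$ be a Banach space with the approximation property and let $m:\Sigma\to X$ be a countably additive vector measure such that the integration map $I_m:L^1(m)\to X$ is weakly compact. Then there is a net $(R^\alpha_m)_\alpha$ of finite rank Radon-Nikodým derivative operators of $m$, each of norm $\le 1$ as an operator $L^1(m)\to X$, that converges to $I_m$ in the strong operator topology; that is, for every $f\in L^1(m)$, $$\lim_\alpha R^\alpha_m(f)=\int f\,dm=I_m(f).$$
   Context: Scalars are real. $(\Omega,\Sigma)$ is a measurable space and $m:\Sigma\to X$ is a countably additive vector measure. For $x^*\in X^*$, $\langle m,x^*\rangle(A):=\langle m(A),x^*\rangle$ is a scalar measure with variation $|\langle m,x^*\rangle|$. The semivariation is $\|m\|(A)=\sup_{\|x^*\|\le 1}|\langle m,x^*\rangle|(A)$; functions that agree off a set $A$ with $\|m\|(A)=0$ are identified. A measurable $f:\Omega\to\mathbb R$ is $m$-integrable if it is integrable with respect to $\langle m,x^*\rangle$ for every $x^*\in X^*$ and for each $A\in\Sigma$ there is an element $\int_A f\,dm\in X$ with $\langle\int_A f\,dm,x^*\rangle=\int_A f\,d\langle m,x^*\rangle$ for all $x^*\in X^*$. $L^1(m)$ is the Banach lattice of ($m$-a.e. classes of) $m$-integrable functions with norm $\|f\|_{L^1(m)}=\sup_{x^*\in B_{X^*}}\int|f|\,d|\langle m,x^*\rangle|$. The integration map is $I_m:L^1(m)\to X$, $I_m(f)=\int_\Omega f\,dm$. Fix a finite positive measure $\mu$ equivalent to $m$ (i.e. $\mu(A)=0$ iff $\|m\|(A)=0$), for example a Rybakov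 measure $|\langle m,x_0^*\rangle|$. For $x^*\in X^*$ let $\varphi^m_{x^*}:=\frac{d\langle m,x^*\rangle}{d\mu}$ be the Radon-Nikodým derivative; it acts as a functional on $L^1(m)$ by $\varphi^m_{x^*}(f)=\int f\varphi^m_{x^*}\,d\mu$. A finite rank Radon-Nikodým derivative operator of $m$ is an operator $R_m:L^1(m)\to X$ of the form $R_m(f)=\sum_{i=1}^n\varphi^m_{x_i^*}(f)\,x_i$ with $n\in\mathbb N$, $x_i^*\in X^*$, $x_i\in X$. *)

theory Defs
  imports "HOL-Analysis.Analysis"
begin

text \<open>
  A measurable space is given by a measure \<open>M\<close>, of which only \<open>space M\<close> and \<open>sets M\<close>
  are used. Signed and vector measures are set functions whose values outside \<open>sets M\<close> are
  irrelevant. The dual space of \<open>'x\<close> is the type \<open>'x \<Rightarrow>\<^sub>L real\<close>.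
\<close>

subsection \<open>Vector measures, variation and semivariation\<close>

definition vector_measure :: "'a measure \<Rightarrow> ('a set \<Rightarrow> 'x::real_normed_vector) \<Rightarrow> bool" where
  "vector_measure M m \<longleftrightarrow>
     (\<forall>A. range A \<subseteq> sets M \<longrightarrow> disjoint_family A \<longrightarrow> (\<lambda>i::nat. m (A i)) sums m (\<Union>i. A i))"

definition scalar_measure ::
    "('a set \<Rightarrow> 'x::real_normed_vector) \<Rightarrow> ('x \<Rightarrow>\<^sub>L real) \<Rightarrow> 'a set \<Rightarrow> real" where
  "scalar_measure m x' = (\<lambda>A. blinfun_apply x' (m A))"

definition variation :: "'a measure \<Rightarrow> ('a set \<Rightarrow> real) \<Rightarrow> 'a set \<Rightarrow> ennreal" where
  "variation M \<nu> A =
     (SUP P \<in> {P. finite P \<and> P \<subseteq> sets M \<and> partition_on A P}. \<Sum>B\<in>P. ennreal \<bar>\<nu> B\<bar>)"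

definition variation_measure :: "'a measure \<Rightarrow> ('a set \<Rightarrow> real) \<Rightarrow> 'a measure" where
  "variation_measure M \<nu> = measure_of (space M) (sets M) (variation M \<nu>)"

definition semivariation ::
    "'a measure \<Rightarrow> ('a set \<Rightarrow> 'x::real_normed_vector) \<Rightarrow> 'a set \<Rightarrow> ennreal" where
  "semivariation M m A =
     (SUP x' \<in> {x' :: 'x \<Rightarrow>\<^sub>L real. norm x' \<le> 1}. variation M (scalar_measure m x') A)"

subsection \<open>Integration with respect to a signed measure\<close>

text \<open>
  The positive part in the Jordan decomposition of a signed measure \<open>\<nu>\<close>; the negative part is
  the positive part of \<open>-\<nu>\<close>. Since \<open>\<nu> {} = 0\<close>, truncating negative values of \<open>\<nu> B\<close> to
  \<open>0\<close> by \<open>ennreal\<close> does not change the supremum.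
\<close>

definition positive_part :: "'a measure \<Rightarrow> ('a set \<Rightarrow> real) \<Rightarrow> 'a measure" where
  "positive_part M \<nu> =
     measure_of (space M) (sets M) (\<lambda>A. SUP B \<in> {B \<in> sets M. B \<subseteq> A}. ennreal (\<nu> B))"

definition signed_integrable :: "'a measure \<Rightarrow> ('a set \<Rightarrow> real) \<Rightarrow> ('a \<Rightarrow> real) \<Rightarrow> bool" where
  "signed_integrable M \<nu> f \<longleftrightarrow> integrable (variation_measure M \<nu>) f"

definition signed_integral ::
    "'a measure \<Rightarrow> ('a set \<Rightarrow> real) \<Rightarrow> 'a set \<Rightarrow> ('a \<Rightarrow> real) \<Rightarrow> real" where
  "signed_integral M \<nu> A f =
     (LINT \<omega>:A|positive_part M \<nu>. f \<omega>) - (LINT \<omega>:A|positive_part M (\<lambda>B. - \<nu> B). f \<omega>)"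

subsection \<open>Integration with respect to a vector measure\<close>

definition vm_integrable ::
    "'a measure \<Rightarrow> ('a set \<Rightarrow> 'x::real_normed_vector) \<Rightarrow> ('a \<Rightarrow> real) \<Rightarrow> bool" where
  "vm_integrable M m f \<longleftrightarrow>
     f \<in> borel_measurable M \<and>
     (\<forall>x' :: 'x \<Rightarrow>\<^sub>L real. signed_integrable M (scalar_measure m x') f) \<and>
     (\<forall>A\<in>sets M. \<exists>y. \<forall>x' :: 'x \<Rightarrow>\<^sub>L real.
        blinfun_apply x' y = signed_integral M (scalar_measure m x') A f)"

definition vm_integral ::
    "'a measure \<Rightarrow> ('a set \<Rightarrow> 'x::real_normed_vector) \<Rightarrow> 'a set \<Rightarrow> ('a \<Rightarrow> real) \<Rightarrow> 'x" where
  "vm_integral M m A f =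
     (THE y. \<forall>x' :: 'x \<Rightarrow>\<^sub>L real. blinfun_apply x' y = signed_integral M (scalar_measure m x') A f)"

text \<open>
  Elements of $L^1(m)$ are represented by functions rather than by their $m$-a.e. classes. All
  notions below (\<open>L1_norm\<close>, \<open>integration_map\<close>, \<open>RN_functional\<close>) depend only on the class.
  The norm is taken in \<open>ennreal\<close>, so that the supremum is meaningful without a boundedness proof.
\<close>

definition L1 :: "'a measure \<Rightarrow> ('a set \<Rightarrow> 'x::real_normed_vector) \<Rightarrow> ('a \<Rightarrow> real) set" where
  "L1 M m = {f. vm_integrable M m f}"

definition L1_norm ::
    "'a measure \<Rightarrow> ('a set \<Rightarrow> 'x::real_normed_vector) \<Rightarrow> ('a \<Rightarrow> real) \<Rightarrow> ennreal" where
  "L1_norm M m f =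
     (SUP x' \<in> {x' :: 'x \<Rightarrow>\<^sub>L real. norm x' \<le> 1}.
        \<integral>\<^sup>+\<omega>. ennreal \<bar>f \<omega>\<bar> \<partial>variation_measure M (scalar_measure m x'))"

definition L1_unit_ball ::
    "'a measure \<Rightarrow> ('a set \<Rightarrow> 'x::real_normed_vector) \<Rightarrow> ('a \<Rightarrow> real) set" where
  "L1_unit_ball M m = {f \<in> L1 M m. L1_norm M m f \<le> 1}"

definition integration_map ::
    "'a measure \<Rightarrow> ('a set \<Rightarrow> 'x::real_normed_vector) \<Rightarrow> ('a \<Rightarrow> real) \<Rightarrow> 'x" where
  "integration_map M m f = vm_integral M m (space M) f"

definition L1_opnorm ::
    "'a measure \<Rightarrow> ('a set \<Rightarrow> 'x::real_normed_vector) \<Rightarrow> (('a \<Rightarrow> real) \<Rightarrow> 'x) \<Rightarrow> ennreal" where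
  "L1_opnorm M m T = (SUP f \<in> L1_unit_ball M m. ennreal (norm (T f)))"

subsection \<open>Weak compactness and the approximation property\<close>

definition weak_topology :: "'x::real_normed_vector topology" where
  "weak_topology =
     topology_generated_by {blinfun_apply x' -` U | (x' :: 'x \<Rightarrow>\<^sub>L real) U. open U}"

definition weakly_compact_on_L1 ::
    "'a measure \<Rightarrow> ('a set \<Rightarrow> 'x::real_normed_vector) \<Rightarrow> (('a \<Rightarrow> real) \<Rightarrow> 'x) \<Rightarrow> bool" where
  "weakly_compact_on_L1 M m T \<longleftrightarrow>
     compactin weak_topology (weak_topology closure_of (T ` L1_unit_ball M m))"

definition finite_rank :: "('x::real_normed_vector \<Rightarrow>\<^sub>L 'y::real_normed_vector) \<Rightarrow> bool" where
  "finite_rank T \<longleftrightarrow> (\<exists>B. finite B \<and> range (blinfun_apply T) \<subseteq> span B)"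

definition approximation_property :: "'x::real_normed_vector itself \<Rightarrow> bool" where
  "approximation_property _ \<longleftrightarrow>
     (\<forall>K :: 'x set. \<forall>\<epsilon>>0. compact K \<longrightarrow>
        (\<exists>T :: 'x \<Rightarrow>\<^sub>L 'x. finite_rank T \<and> (\<forall>x\<in>K. norm (blinfun_apply T x - x) \<le> \<epsilon>)))"

subsection \<open>Radon-Nikodym derivative operators\<close>

definition equivalent_measure ::
    "'a measure \<Rightarrow> ('a set \<Rightarrow> 'x::real_normed_vector) \<Rightarrow> 'a measure \<Rightarrow> bool" where
  "equivalent_measure M m \<mu> \<longleftrightarrow>
     sets \<mu> = sets M \<and> (\<forall>A\<in>sets M. emeasure \<mu> A = 0 \<longleftrightarrow> semivariation M m A = 0)"

text \<open>
  The library function \<open>RN_deriv\<close> covers positive measures only. The derivative of a signed measure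
  is determined up to a \<open>\<mu>\<close>-null set; a version is chosen.
\<close>

definition signed_RN_deriv :: "'a measure \<Rightarrow> ('a set \<Rightarrow> real) \<Rightarrow> 'a \<Rightarrow> real" where
  "signed_RN_deriv \<mu> \<nu> =
     (SOME h. integrable \<mu> h \<and> (\<forall>A\<in>sets \<mu>. \<nu> A = (LINT \<omega>:A|\<mu>. h \<omega>)))"

definition RN_functional ::
    "'a measure \<Rightarrow> ('a set \<Rightarrow> 'x::real_normed_vector) \<Rightarrow> ('x \<Rightarrow>\<^sub>L real) \<Rightarrow> ('a \<Rightarrow> real) \<Rightarrow> real" where
  "RN_functional \<mu> m x' f = (LINT \<omega>|\<mu>. f \<omega> * signed_RN_deriv \<mu> (scalar_measure m x') \<omega>)"

definition finite_rank_RN_operator ::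
    "'a measure \<Rightarrow> 'a measure \<Rightarrow> ('a set \<Rightarrow> 'x::real_normed_vector) \<Rightarrow> (('a \<Rightarrow> real) \<Rightarrow> 'x) \<Rightarrow> bool" where
  "finite_rank_RN_operator M \<mu> m R \<longleftrightarrow>
     (\<exists>(n::nat) (x' :: nat \<Rightarrow> 'x \<Rightarrow>\<^sub>L real) (x :: nat \<Rightarrow> 'x).
        \<forall>f\<in>L1 M m. R f = (\<Sum>i<n. RN_functional \<mu> m (x' i) f *\<^sub>R x i))"

subsection \<open>Nets\<close>

definition directed_set :: "'i set \<Rightarrow> ('i \<Rightarrow> 'i \<Rightarrow> bool) \<Rightarrow> bool" where
  "directed_set D le \<longleftrightarrow>
     D \<noteq> {} \<and> reflp_on D le \<and> transp_on D le \<and> (\<forall>a\<in>D. \<forall>b\<in>D. \<exists>c\<in>D. le a c \<and> le b c)"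

definition net_filter :: "'i set \<Rightarrow> ('i \<Rightarrow> 'i \<Rightarrow> bool) \<Rightarrow> 'i filter" where
  "net_filter D le = (INF a\<in>D. principal {b\<in>D. le a b})"

lemma eventually_net_filter:
  assumes "directed_set D le"
  shows "eventually P (net_filter D le) \<longleftrightarrow> (\<exists>a\<in>D. \<forall>b\<in>D. le a b \<longrightarrow> P b)"
proof -
  have "\<exists>c\<in>D. principal {x\<in>D. le c x} \<le> inf (principal {x\<in>D. le a x}) (principal {x\<in>D. le b x})"
    if ab: "a \<in> D" "b \<in> D" for a b
  proof -
    obtain c where "c \<in> D" "le a c" "le b c"
      using assms ab unfolding directed_set_def by blast
    moreover have "transp_on D le" using assms unfolding directed_set_def by blast
    ultimately show ?thesis
      using ab by (auto intro!: bexI[of _ c] dest: transp_onD)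
  qed
  moreover have "D \<noteq> {}" using assms unfolding directed_set_def by blast
  ultimately show ?thesis
    unfolding net_filter_def by (subst eventually_INF_base) (auto simp: eventually_principal)
qed

end

theory Submission imports Defs "HOL-Library.Function_Algebras" begin

text \<open>
  Write \<open>T\<close> for the integration map. On $L^1(m)$ the functional $\varphi_{x'}$ is \<open>f \<mapsto> x' (T f)\<close>, so the
  finite rank Radon-Nikodym derivative operators are the maps \<open>S \<circ> T\<close> with \<open>S\<close> of finite rank on the
  Banach space. The map \<open>T\<close> sends the unit ball of $L^1(m)$ into the unit ball of that space, and the
  image has a weakly compact weak closure \<open>W\<close>. Everything therefore reduces to the following fact
  (\<open>finite_rank_contraction_on_weakly_compact\<close>): under the approximation property, if \<open>W\<close> is a weakly
  compact part of the unit ball, \<open>E\<close> is finite and \<open>e > 0\<close>, then some finite rank \<open>S\<close> moves the points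
  of \<open>E\<close> by at most \<open>e\<close> and satisfies \<open>norm (S w) \<le> 1\<close> for all \<open>w \<in> W\<close>. The approximation property by
  itself gives such operators without any control on \<open>W\<close>, which need not be norm compact.

  Control on \<open>W\<close> comes from a minimax argument. Suppose that \<open>w \<mapsto> norm (S w)\<close> reaches \<open>1 + 5 e\<close> somewhere on
  \<open>W\<close> for every finite rank \<open>S\<close> that is \<open>e\<close>-close to the identity on \<open>E\<close>. These operators form a convex
  set and \<open>w \<mapsto> norm (S w)\<close> is weakly continuous, so the Hahn-Banach theorem, in the form of Mazur and
  Orlicz, produces one mean \<open>L\<close> on the weakly continuous functions on \<open>W\<close> that gives all these functions a
  value of at least \<open>1 + 5 e\<close> (\<open>minimax_mean\<close>). It then suffices to find, for this \<open>L\<close>, a single \<open>S\<close>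
  whose mean is at most \<open>1 + 4 e\<close> (\<open>finite_rank_small_mean\<close>).

  This is possible because \<open>L\<close> is almost carried by norm compact sets: for each \<open>d > 0\<close> there is a finite
  set \<open>A\<close> such that the norm distance to \<open>A\<close> has mean at most \<open>d\<close>
  (\<open>mean_on_weakly_compact_tight\<close>). Choosing \<open>A k\<close> with mean distance $8^{-k}$ and telescoping \<open>w\<close> along its
  nearest points in \<open>A 0, A 1, \<dots>\<close>, the differences of consecutive points, suitably rescaled, form a norm
  compact set; an \<open>S\<close> that the approximation property provides for that set has a small mean.

  Tightness plays the role of the statement that a Radon measure on a weakly compact set lives on a norm
  separable subset. It rests on two classical facts. Means on a compact space are continuous along
  decreasing sequences (\<open>mean_on_Daniell\<close>), and a set that is weakly dense has norm dense convex
  combinations (Mazur). The latter is applied to the seminorm given by countably many functionals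
  (\<open>weakly_dense_convex_combinations\<close>), which makes a countable set of points sufficient although \<open>W\<close>
  itself may be nonseparable.
\<close>

section \<open>Sublinear functionals and the Mazur-Orlicz theorem\<close>

text \<open>
  With the pointwise vector space structure on functions, one Hahn-Banach theorem serves both the
  normed space and the space of weakly continuous functions on a subset of it.
\<close>

instantiation "fun" :: (type, real_vector) real_vector
begin
definition scaleR_fun_def: "r *\<^sub>R f = (\<lambda>x. r *\<^sub>R f x)"
instance by standard (simp_all add: scaleR_fun_def fun_eq_iff algebra_simps)
end

lemma scaleR_fun_apply [simp]: "(r *\<^sub>R f) x = r *\<^sub>R f x"
  by (simp add: scaleR_fun_def)

definition sublinear_on :: "'v::real_vector set \<Rightarrow> ('v \<Rightarrow> real) \<Rightarrow> bool" where
  "sublinear_on V p \<longleftrightarrow>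
     (\<forall>x\<in>V. \<forall>y\<in>V. p (x + y) \<le> p x + p y) \<and> (\<forall>x\<in>V. \<forall>t\<ge>0. p (t *\<^sub>R x) = t * p x)"

definition linear_form_on :: "'v::real_vector set \<Rightarrow> ('v \<Rightarrow> real) \<Rightarrow> bool" where
  "linear_form_on V f \<longleftrightarrow>
     (\<forall>x\<in>V. \<forall>y\<in>V. f (x + y) = f x + f y) \<and> (\<forall>x\<in>V. \<forall>c. f (c *\<^sub>R x) = c * f x)"

lemma sublinear_on_add: "sublinear_on V p \<Longrightarrow> x \<in> V \<Longrightarrow> y \<in> V \<Longrightarrow> p (x + y) \<le> p x + p y"
  and sublinear_on_scale: "sublinear_on V p \<Longrightarrow> x \<in> V \<Longrightarrow> 0 \<le> t \<Longrightarrow> p (t *\<^sub>R x) = t * p x"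
  by (auto simp: sublinear_on_def)

lemma sublinear_on_minus:
  assumes "sublinear_on V p" "subspace V" "x \<in> V"
  shows "- p (- x) \<le> p x"
proof -
  have "p 0 = 0" using sublinear_on_scale[OF assms(1) assms(3), of 0] by simp
  moreover have "p (x + - x) \<le> p x + p (- x)"
    using assms by (intro sublinear_on_add) (auto simp: subspace_neg)
  ultimately show ?thesis by simp
qed

text \<open>
  The functional \<open>q\<close> is the largest sublinear functional below \<open>p\<close> with \<open>q (- h) \<le> - c\<close> on \<open>H\<close>, so that
  every linear functional below \<open>q\<close> is at least \<open>c\<close> on \<open>H\<close>. The hypothesis \<open>convex\<close> says that \<open>H\<close> is convex
  as far as \<open>p\<close> can see: a weighted combination of two elements may be replaced by a multiple of a third.
  This weak form is what a family of convex functions \<open>w \<mapsto> norm (S w)\<close> satisfies.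
\<close>

lemma sublinear_on_tilt:
  assumes V: "subspace V" and p: "sublinear_on V p"
    and H: "H \<subseteq> V" "H \<noteq> {}" and c: "\<forall>h\<in>H. c \<le> p h"
    and convex: "\<forall>h1\<in>H. \<forall>h2\<in>H. \<forall>s\<ge>0. \<forall>t\<ge>0.
        \<exists>h\<in>H. \<forall>g\<in>V. p (g + (s + t) *\<^sub>R h) \<le> p (g + s *\<^sub>R h1 + t *\<^sub>R h2)"
  defines "q \<equiv> \<lambda>g. INF (s, h) \<in> {0..} \<times> H. p (g + s *\<^sub>R h) - s * c"
  shows "sublinear_on V q" and "\<And>g. g \<in> V \<Longrightarrow> q g \<le> p g"
    and "\<And>g h. g \<in> V \<Longrightarrow> h \<in> H \<Longrightarrow> q (- h) \<le> - c"
proof -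
  have p0: "p 0 = 0" using sublinear_on_scale[OF p, of 0 0] V by (simp add: subspace_0)
  have HV: "h \<in> V" if "h \<in> H" for h using H that by auto
  have low: "- p (- g) \<le> p (g + s *\<^sub>R h) - s * c" if "g \<in> V" "h \<in> H" "0 \<le> s" for g h s
  proof -
    have "s * c \<le> p (s *\<^sub>R h)"
      using sublinear_on_scale[OF p HV[OF that(2)] that(3)] c that
      by (simp add: mult_left_mono)
    also have "s *\<^sub>R h = (g + s *\<^sub>R h) + - g" by simp
    also have "p \<dots> \<le> p (g + s *\<^sub>R h) + p (- g)"
      using V that HV by (intro sublinear_on_add[OF p]) (auto simp: subspace_neg subspace_add subspace_scale)
    finally show ?thesis by simp
  qed
  have bdd: "bdd_below ((\<lambda>(s, h). p (g + s *\<^sub>R h) - s * c) ` ({0..} \<times> H))" if "g \<in> V" for g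
    using low[OF that] by (intro bdd_belowI2[where m = "- p (- g)"]) auto
  have upper: "q g \<le> p (g + s *\<^sub>R h) - s * c" if "g \<in> V" "h \<in> H" "0 \<le> s" for g h s
    using cINF_lower[OF bdd[OF that(1)], of "(s, h)"] that by (simp add: q_def)
  have greatest: "b \<le> q g" if "\<And>h s. h \<in> H \<Longrightarrow> 0 \<le> s \<Longrightarrow> b \<le> p (g + s *\<^sub>R h) - s * c" for b g
    unfolding q_def using H(2) that by (intro cINF_greatest) auto
  obtain h0 where h0: "h0 \<in> H" using H(2) by auto
  show qp: "q g \<le> p g" if "g \<in> V" for g
    using upper[OF that h0, of 0] by simp
  show "q (- h) \<le> - c" if "h \<in> H" for g h
    using upper[of "- h" h 1] that HV V p0 by (simp add: subspace_neg)
  have q0: "q 0 = 0"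
  proof (rule antisym)
    show "q 0 \<le> 0" using qp[of 0] V p0 by (simp add: subspace_0)
    show "0 \<le> q 0" using low[of 0] V p0 by (intro greatest) (auto simp: subspace_0)
  qed
  have add: "q (x + y) \<le> q x + q y" if xy: "x \<in> V" "y \<in> V" for x y
  proof -
    have 1: "q (x + y) \<le> (p (x + s *\<^sub>R h1) - s * c) + (p (y + t *\<^sub>R h2) - t * c)"
      if h: "h1 \<in> H" "h2 \<in> H" "0 \<le> s" "0 \<le> t" for h1 h2 s t
    proof -
      obtain h where hh: "h \<in> H" "\<And>g. g \<in> V \<Longrightarrow> p (g + (s + t) *\<^sub>R h) \<le> p (g + s *\<^sub>R h1 + t *\<^sub>R h2)"
        using convex h by blast
      have "q (x + y) \<le> p ((x + y) + (s + t) *\<^sub>R h) - (s + t) * c"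
        using xy V hh(1) h by (intro upper) (auto simp: subspace_add)
      also have "p ((x + y) + (s + t) *\<^sub>R h) \<le> p (x + y + s *\<^sub>R h1 + t *\<^sub>R h2)"
        using hh(2) xy V by (auto simp: subspace_add)
      also have "x + y + s *\<^sub>R h1 + t *\<^sub>R h2 = (x + s *\<^sub>R h1) + (y + t *\<^sub>R h2)"
        by (simp add: algebra_simps)
      also have "p \<dots> \<le> p (x + s *\<^sub>R h1) + p (y + t *\<^sub>R h2)"
        using xy V h HV by (intro sublinear_on_add[OF p]) (auto simp: subspace_add subspace_scale)
      finally show ?thesis by (simp add: algebra_simps)
    qed
    have 2: "q (x + y) - q y \<le> p (x + s *\<^sub>R h1) - s * c" if "h1 \<in> H" "0 \<le> s" for h1 s
    proof -
      have "q (x + y) - (p (x + s *\<^sub>R h1) - s * c) \<le> q y"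
      proof (rule greatest)
        fix h2 t assume "h2 \<in> H" "(0::real) \<le> t"
        then show "q (x + y) - (p (x + s *\<^sub>R h1) - s * c) \<le> p (y + t *\<^sub>R h2) - t * c"
          using 1[OF that(1) _ that(2), of h2 t] by simp
      qed
      then show ?thesis by simp
    qed
    then have "q (x + y) - q y \<le> q x" by (rule greatest)
    then show ?thesis by simp
  qed
  have scale_le: "q (t *\<^sub>R x) \<le> t * q x" if "x \<in> V" "0 < t" for x t
  proof -
    have "q (t *\<^sub>R x) / t \<le> q x"
    proof (rule greatest)
      fix h s assume h: "h \<in> H" "(0::real) \<le> s"
      have "q (t *\<^sub>R x) \<le> p (t *\<^sub>R x + (t * s) *\<^sub>R h) - (t * s) * c"
        using that h V by (intro upper) (auto simp: subspace_scale)
      also have "t *\<^sub>R x + (t * s) *\<^sub>R h = t *\<^sub>R (x + s *\<^sub>R h)" by (simp add: algebra_simps)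
      also have "p \<dots> = t * p (x + s *\<^sub>R h)"
        using that h V HV by (intro sublinear_on_scale[OF p]) (auto simp: subspace_add subspace_scale)
      finally show "q (t *\<^sub>R x) / t \<le> p (x + s *\<^sub>R h) - s * c"
        using that by (simp add: field_simps)
    qed
    then show ?thesis using that by (simp add: field_simps)
  qed
  have scale: "q (t *\<^sub>R x) = t * q x" if "x \<in> V" "0 \<le> t" for x t
  proof (cases "t = 0")
    case False
    then have t: "0 < t" using that by simp
    have "q ((1/t) *\<^sub>R (t *\<^sub>R x)) \<le> (1/t) * q (t *\<^sub>R x)"
      using that V t by (intro scale_le) (auto simp: subspace_scale)
    then have "t * q x \<le> q (t *\<^sub>R x)" using t by (simp add: field_simps)
    with scale_le[OF that(1) t] show ?thesis by simp
  qed (simp add: q0)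
  show "sublinear_on V q" using add scale by (auto simp: sublinear_on_def)
qed

text \<open>
  Tilting \<open>p\<close> along a single vector \<open>y\<close> gives a sublinear functional below \<open>p\<close> whose value at \<open>- y\<close> is at
  most \<open>- p y\<close>. By minimality this is \<open>p\<close> itself, and \<open>p (- y) \<le> - p y\<close> turns subadditivity into
  additivity.
\<close>

lemma minimal_sublinear_is_linear:
  assumes V: "subspace V" and p: "sublinear_on V p"
    and min: "\<And>q. sublinear_on V q \<Longrightarrow> (\<And>x. x \<in> V \<Longrightarrow> q x \<le> p x) \<Longrightarrow> (\<And>x. x \<in> V \<Longrightarrow> q x = p x)"
  shows "linear_form_on V p"
proof -
  have superadd: "p x + p y \<le> p (x + y)" if xy: "x \<in> V" "y \<in> V" for x y
  proof -
    define q where "q = (\<lambda>g. INF (s, h) \<in> {0..} \<times> {y}. p (g + s *\<^sub>R h) - s * p y)"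
    have conv: "\<forall>h1\<in>{y}. \<forall>h2\<in>{y}. \<forall>s\<ge>0. \<forall>t\<ge>0.
        \<exists>h\<in>{y}. \<forall>g\<in>V. p (g + (s + t) *\<^sub>R h) \<le> p (g + s *\<^sub>R h1 + t *\<^sub>R h2)"
      by (auto simp: algebra_simps)
    have y: "{y} \<subseteq> V" "{y} \<noteq> {}" "\<forall>h\<in>{y}. p y \<le> p h" using xy by auto
    note tilt = sublinear_on_tilt[OF V p y conv, folded q_def]
    have qp: "q g = p g" if "g \<in> V" for g
      by (rule min[OF tilt(1) _ that]) (use tilt(2) in \<open>simp add: q_def\<close>)
    have "q (- y) \<le> - p y" using tilt(3)[of y y] xy by (simp add: q_def)
    then have "p (- y) \<le> - p y" using qp[of "- y"] xy V by (simp add: subspace_neg)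
    moreover have "p ((x + y) + - y) \<le> p (x + y) + p (- y)"
      using xy V by (intro sublinear_on_add[OF p]) (auto simp: subspace_add subspace_neg)
    ultimately show ?thesis by simp
  qed
  have add: "p (x + y) = p x + p y" if "x \<in> V" "y \<in> V" for x y
    using superadd[OF that] sublinear_on_add[OF p that] by simp
  have p0: "p 0 = 0" using sublinear_on_scale[OF p, of 0 0] V by (simp add: subspace_0)
  have neg: "p (- x) = - p x" if "x \<in> V" for x
    using add[of x "- x"] that V p0 by (simp add: subspace_neg)
  have "p (c *\<^sub>R x) = c * p x" if "x \<in> V" for c x
  proof (cases "0 \<le> c")
    case False
    then have "p ((- c) *\<^sub>R x) = (- c) * p x" using that by (intro sublinear_on_scale[OF p]) auto
    moreover have "p (- ((- c) *\<^sub>R x)) = - p ((- c) *\<^sub>R x)"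
      using that V by (intro neg) (auto simp: subspace_scale subspace_neg)
    ultimately show ?thesis by simp
  qed (use sublinear_on_scale[OF p that] in auto)
  with add show ?thesis by (auto simp: linear_form_on_def)
qed

text \<open>
  The Hahn-Banach theorem. Zorn's lemma is applied to the sublinear functionals below \<open>p\<close> and not to
  partial linear functionals; a chain has its pointwise infimum as a lower bound, since every \<open>q\<close> below
  \<open>p\<close> satisfies \<open>- p (- x) \<le> q x\<close>.
\<close>

lemma sublinear_dominates_linear:
  assumes V: "subspace V" and p: "sublinear_on V p"
  shows "\<exists>f. linear_form_on V f \<and> (\<forall>x\<in>V. f x \<le> p x)"
proof -
  \<comment> \<open>Setting the values off \<open>V\<close> to zero makes a member of \<open>Q\<close> determined by its values on \<open>V\<close>.\<close>
  define Q where "Q = {q. sublinear_on V q \<and> (\<forall>x\<in>V. q x \<le> p x) \<and> (\<forall>x. x \<notin> V \<longrightarrow> q x = 0)}"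
  have neg: "- x \<in> V" if "x \<in> V" for x using V that by (simp add: subspace_neg)
  have low: "- p (- x) \<le> q x" if "q \<in> Q" "x \<in> V" for q x
  proof -
    have "- q (- x) \<le> q x" using that V by (intro sublinear_on_minus[of V]) (auto simp: Q_def)
    moreover have "q (- x) \<le> p (- x)" using that neg by (auto simp: Q_def)
    ultimately show ?thesis by simp
  qed
  define P :: "('a \<Rightarrow> real) \<Rightarrow> ('a \<Rightarrow> real) \<Rightarrow> bool" where "P = (\<lambda>q1 q2. q2 \<le> q1)"
  have "\<exists>q\<in>Q. \<forall>r\<in>Q. P q r \<longrightarrow> r = q"
  proof (rule predicate_Zorn)
    show "partial_order_on Q (relation_of P Q)"
      by (auto simp: partial_order_on_def preorder_on_def refl_on_def trans_def antisym_def
          relation_of_def P_def)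
  next
    fix C assume C: "C \<in> Chains (relation_of P Q)"
    then have CQ: "C \<subseteq> Q" by (auto simp: Chains_def relation_of_def)
    have chain: "a \<le> b \<or> b \<le> a" if "a \<in> C" "b \<in> C" for a b
      using C that by (auto simp: Chains_def relation_of_def P_def)
    define p0 where "p0 = (\<lambda>x. if x \<in> V then p x else 0)"
    have p0Q: "p0 \<in> Q" using p V by (auto simp: Q_def p0_def sublinear_on_def subspace_add subspace_scale)
    show "\<exists>u\<in>Q. \<forall>a\<in>C. P a u"
    proof (cases "C = {}")
      case True then show ?thesis using p0Q by auto
    next
      case False
      define u where "u = (\<lambda>x. if x \<in> V then INF q\<in>C. q x else 0)"
      have bdd: "bdd_below ((\<lambda>q. q x) ` C)" if "x \<in> V" for x
        using low that CQ by (intro bdd_belowI2[where m = "- p (- x)"]) auto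
      have u_le: "u x \<le> q x" if "q \<in> C" "x \<in> V" for q x
        using cINF_lower[OF bdd[OF that(2)] that(1)] that by (simp add: u_def)
      have u_ge: "b \<le> u x" if "x \<in> V" "\<And>q. q \<in> C \<Longrightarrow> b \<le> q x" for b x
        using cINF_greatest[OF False, of b "\<lambda>q. q x"] that by (simp add: u_def)
      obtain q0 where q0: "q0 \<in> C" using False by auto
      have uadd: "u (x + y) \<le> u x + u y" if xy: "x \<in> V" "y \<in> V" for x y
      proof -
        have xyV: "x + y \<in> V" using xy V by (simp add: subspace_add)
        have 1: "u (x + y) \<le> a x + b y" if ab: "a \<in> C" "b \<in> C" for a b
        proof -
          obtain d where d: "d \<in> C" "d \<le> a" "d \<le> b" using chain[OF ab] ab by auto
          have "u (x + y) \<le> d (x + y)" using u_le d(1) xyV by auto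
          also have "\<dots> \<le> d x + d y" using d(1) CQ xy by (auto simp: Q_def sublinear_on_def)
          also have "\<dots> \<le> a x + b y" using d by (auto simp: le_fun_def intro: add_mono)
          finally show ?thesis .
        qed
        have "u (x + y) - u y \<le> a x" if "a \<in> C" for a
        proof -
          have "u (x + y) - a x \<le> u y" using 1[OF that] xy by (intro u_ge) (auto simp: algebra_simps)
          then show ?thesis by simp
        qed
        then have "u (x + y) - u y \<le> u x" using xy by (intro u_ge) auto
        then show ?thesis by simp
      qed
      have uscale_le: "u (t *\<^sub>R x) \<le> t * u x" if "x \<in> V" "0 < t" for x t
      proof -
        have "u (t *\<^sub>R x) / t \<le> u x"
        proof (rule u_ge[OF that(1)])
          fix q assume q: "q \<in> C"
          have "u (t *\<^sub>R x) \<le> q (t *\<^sub>R x)" using u_le q that V by (auto simp: subspace_scale)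
          also have "\<dots> = t * q x" using q CQ that by (auto simp: Q_def sublinear_on_def)
          finally show "u (t *\<^sub>R x) / t \<le> q x" using that by (simp add: field_simps)
        qed
        then show ?thesis using that by (simp add: field_simps)
      qed
      have uscale: "u (t *\<^sub>R x) = t * u x" if "x \<in> V" "0 \<le> t" for x t
      proof (cases "t = 0")
        case True
        have "q 0 = 0" if "q \<in> C" for q
          using CQ that sublinear_on_scale[of V q 0 0] V by (auto simp: Q_def subspace_0)
        then have "(INF q\<in>C. q 0) = (INF q\<in>C. 0)" by (intro INF_cong) auto
        then have "u 0 = 0" using \<open>C \<noteq> {}\<close> V by (simp add: u_def subspace_0)
        then show ?thesis using True by simp
      next
        case False
        then have t: "0 < t" using that by simp
        have "u ((1/t) *\<^sub>R (t *\<^sub>R x)) \<le> (1/t) * u (t *\<^sub>R x)"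
          using that V t by (intro uscale_le) (auto simp: subspace_scale)
        then have "t * u x \<le> u (t *\<^sub>R x)" using t by (simp add: field_simps)
        with uscale_le[OF that(1) t] show ?thesis by simp
      qed
      have "u x \<le> p x" if "x \<in> V" for x
        using u_le[OF q0 that] q0 CQ that by (force simp: Q_def)
      then have "u \<in> Q" using uadd uscale by (auto simp: Q_def sublinear_on_def u_def)
      moreover have "P a u" if "a \<in> C" for a
        using u_le[OF that] that CQ by (auto simp: P_def le_fun_def u_def Q_def)
      ultimately show ?thesis by blast
    qed
  qed
  then obtain q where q: "q \<in> Q" "\<And>r. r \<in> Q \<Longrightarrow> P q r \<Longrightarrow> r = q" by blast
  have "linear_form_on V q"
  proof (rule minimal_sublinear_is_linear[OF V])
    show "sublinear_on V q" using q(1) by (simp add: Q_def)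
  next
    fix r x assume r: "sublinear_on V r" "\<And>x. x \<in> V \<Longrightarrow> r x \<le> q x" and x: "x \<in> V"
    define r' where "r' = (\<lambda>x. if x \<in> V then r x else 0)"
    have "r x \<le> p x" if "x \<in> V" for x
      using r(2)[OF that] q(1) that by (force simp: Q_def)
    then have "r' \<in> Q" using r(1) V
      by (auto simp: Q_def r'_def sublinear_on_def subspace_add subspace_scale)
    moreover have "P q r'" using r q(1) by (auto simp: P_def le_fun_def r'_def Q_def)
    ultimately have "r' = q" by (rule q(2))
    then show "r x = q x" using x by (metis r'_def)
  qed
  then show ?thesis using q(1) by (auto simp: Q_def)
qed

text \<open>
  The single separation principle used below. For \<open>H = {x}\<close> and \<open>p = norm\<close> it gives norming functionals, for
  \<open>H\<close> a translate of a convex set it separates a point from that set, and for \<open>p\<close> the supremum of a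
  function over a space it gives a minimax theorem.
\<close>

lemma Mazur_Orlicz:
  assumes V: "subspace V" and p: "sublinear_on V p"
    and H: "H \<subseteq> V" "H \<noteq> {}" and c: "\<forall>h\<in>H. c \<le> p h"
    and convex: "\<forall>h1\<in>H. \<forall>h2\<in>H. \<forall>s\<ge>0. \<forall>t\<ge>0.
        \<exists>h\<in>H. \<forall>g\<in>V. p (g + (s + t) *\<^sub>R h) \<le> p (g + s *\<^sub>R h1 + t *\<^sub>R h2)"
  obtains f where "linear_form_on V f" "\<And>x. x \<in> V \<Longrightarrow> f x \<le> p x" "\<And>h. h \<in> H \<Longrightarrow> c \<le> f h"
proof -
  note tilt = sublinear_on_tilt[OF V p H c convex]
  obtain f where f: "linear_form_on V f"
    and fq: "\<And>x. x \<in> V \<Longrightarrow> f x \<le> (INF (s, h) \<in> {0..} \<times> H. p (x + s *\<^sub>R h) - s * c)"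
    using sublinear_dominates_linear[OF V tilt(1)] by blast
  have "c \<le> f h" if h: "h \<in> H" for h
  proof -
    have hV: "h \<in> V" "- h \<in> V" using h H V by (auto simp: subspace_neg)
    have "f ((-1) *\<^sub>R h) = (-1) * f h" using f hV unfolding linear_form_on_def by blast
    then have "- f h \<le> - c" using fq[OF hV(2)] tilt(3)[OF hV(1) h] by simp
    then show ?thesis by simp
  qed
  with f fq tilt(2) show ?thesis by (intro that) (auto intro: order_trans)
qed

section \<open>Functionals and finite rank operators on normed spaces\<close>

text \<open>
  Domination by a seminorm that is below the norm makes the linear form continuous, and it controls the form
  by those functionals alone from which the seminorm is built.
\<close>

lemma seminorm_dominated_functional:
  fixes s :: "'x::real_normed_vector \<Rightarrow> real"
  assumes add: "\<And>x y. s (x + y) \<le> s x + s y" and scale: "\<And>t x. 0 \<le> t \<Longrightarrow> s (t *\<^sub>R x) = t * s x"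
    and bound: "\<And>x. s x \<le> norm x"
    and H: "convex H" "H \<noteq> {}" and c: "\<And>h. h \<in> H \<Longrightarrow> c \<le> s h"
  obtains f :: "'x \<Rightarrow>\<^sub>L real" where "norm f \<le> 1" "\<And>x. f x \<le> s x" "\<And>h. h \<in> H \<Longrightarrow> c \<le> f h"
proof -
  have "\<exists>h\<in>H. \<forall>g\<in>UNIV. s (g + (u + t) *\<^sub>R h) \<le> s (g + u *\<^sub>R h1 + t *\<^sub>R h2)"
    if "h1 \<in> H" "h2 \<in> H" "0 \<le> u" "0 \<le> t" for h1 h2 u t
  proof (cases "u + t = 0")
    case True
    then have "u = 0" "t = 0" using that by auto
    then show ?thesis using that by auto
  next
    case False
    define h where "h = (u / (u + t)) *\<^sub>R h1 + (t / (u + t)) *\<^sub>R h2"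
    have "h \<in> H" unfolding h_def using that False
      by (intro convexD[OF H(1)]) (auto simp: add_divide_distrib[symmetric])
    moreover have "(u + t) *\<^sub>R h = u *\<^sub>R h1 + t *\<^sub>R h2"
      using False by (simp add: h_def scaleR_add_right)
    ultimately show ?thesis by (auto simp: add.assoc intro!: bexI[of _ h])
  qed
  then obtain f where f: "linear_form_on UNIV f" "\<And>x. f x \<le> s x" "\<And>h. h \<in> H \<Longrightarrow> c \<le> f h"
    using add scale c H(2) by (auto simp: sublinear_on_def intro: Mazur_Orlicz[of UNIV s H c])
  have bdd: "\<bar>f x\<bar> \<le> norm x" for x
  proof -
    have "f ((-1) *\<^sub>R x) = (-1) * f x" using f(1) unfolding linear_form_on_def by blast
    then show ?thesis using f(2)[of x] f(2)[of "- x"] bound[of x] bound[of "- x"] by simp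
  qed
  have "bounded_linear f"
    using f(1) bdd by (intro bounded_linear_intro[where K = 1]) (auto simp: linear_form_on_def)
  then have F: "blinfun_apply (Blinfun f) = f" by (rule bounded_linear_Blinfun_apply)
  show ?thesis
  proof (rule that[of "Blinfun f"])
    show "norm (Blinfun f) \<le> 1" using bdd F by (intro norm_blinfun_bound) auto
  qed (use F f in auto)
qed

lemma norming_functional:
  fixes x :: "'x::real_normed_vector"
  obtains f :: "'x \<Rightarrow>\<^sub>L real" where "norm f \<le> 1" "f x = norm x"
proof -
  obtain f :: "'x \<Rightarrow>\<^sub>L real" where f: "norm f \<le> 1" "\<And>y. f y \<le> norm y" "\<And>h. h \<in> {x} \<Longrightarrow> norm x \<le> f h"
    using seminorm_dominated_functional[of norm "{x}" "norm x"] norm_triangle_ineq by force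
  then show ?thesis using that[of f] by (metis antisym singletonI)
qed

lemma functionals_separate_points:
  fixes x y :: "'x::real_normed_vector"
  assumes "\<And>f :: 'x \<Rightarrow>\<^sub>L real. f x = f y"
  shows "x = y"
proof -
  obtain f :: "'x \<Rightarrow>\<^sub>L real" where "norm f \<le> 1" "f (x - y) = norm (x - y)"
    by (rule norming_functional)
  then show ?thesis using assms[of f] by (simp add: blinfun.diff_right)
qed

text \<open>
  Let \<open>g\<close> be a continuous functional that does not vanish at some value \<open>y\<close> of \<open>S\<close>. Subtracting from \<open>S\<close> the rank
  one operator \<open>x \<mapsto> (g (S x) / g y) *\<^sub>R y\<close> leaves an operator whose range lies in the kernel of \<open>g\<close>, and the
  part of \<open>span B\<close> in that kernel is spanned by one vector less. The coordinates so obtained are continuous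
  because they have the form \<open>g \<circ> S\<close>.
\<close>

lemma finite_rank_expansion:
  fixes S :: "'x::real_normed_vector \<Rightarrow>\<^sub>L 'y::real_normed_vector"
  assumes "finite B" "range (blinfun_apply S) \<subseteq> span B"
  shows "\<exists>(n::nat) (f :: nat \<Rightarrow> 'x \<Rightarrow>\<^sub>L real) (y :: nat \<Rightarrow> 'y). \<forall>x. S x = (\<Sum>i<n. f i x *\<^sub>R y i)"
  using assms
proof (induction "card B" arbitrary: B S rule: less_induct)
  case less
  show ?case
  proof (cases "\<forall>x. S x = 0")
    case True
    then show ?thesis by (intro exI[of _ 0]) auto
  next
    case False
    then obtain x0 where x0: "S x0 \<noteq> 0" by auto
    define y where "y = S x0"
    obtain g :: "'y \<Rightarrow>\<^sub>L real" where "g y = norm y" by (rule norming_functional)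
    then have gy: "g y \<noteq> 0" using x0 y_def by auto
    have lin_g: "linear g" by (simp add: blinfun.bounded_linear_right bounded_linear.linear)
    have "\<exists>b\<in>B. g b \<noteq> 0"
    proof (rule ccontr)
      assume "\<not> ?thesis"
      then have "g z = 0" if "z \<in> span B" for z
        using that linear_eq_0_on_span[OF lin_g, of B z] by auto
      moreover have "y \<in> span B" using less.prems y_def by auto
      ultimately show False using gy by auto
    qed
    then obtain b where b: "b \<in> B" "g b \<noteq> 0" by auto
    \<comment> \<open>\<open>P\<close> projects along \<open>b\<close> onto the kernel of \<open>g\<close>; it kills \<open>b\<close> and fixes that kernel.\<close>
    define P where "P = (\<lambda>z. z - (g z / g b) *\<^sub>R b)"
    have linP: "linear P"
      by (rule linearI) (auto simp: P_def blinfun.add_right blinfun.scaleR_right algebra_simps add_divide_distrib)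
    define S' where "S' = S - (blinfun_scaleR_left y o\<^sub>L ((1 / g y) *\<^sub>R (g o\<^sub>L S)))"
    have S': "S' x = S x - (g (S x) / g y) *\<^sub>R y" for x
      by (simp add: S'_def blinfun.diff_left blinfun.scaleR_left)
    have sub: "range S' \<subseteq> span (P ` (B - {b}))"
    proof
      fix z assume "z \<in> range S'"
      then obtain x where z: "z = S' x" by auto
      have "g z = 0" using gy by (simp add: z S' blinfun.diff_right blinfun.scaleR_right)
      then have "P z = z" by (simp add: P_def)
      moreover have "z \<in> span B"
        using less.prems unfolding z S' by (auto simp: y_def intro!: span_diff span_scale)
      ultimately have "z \<in> P ` span B" by (metis image_eqI)
      also have "P ` span B = span (P ` B)" by (rule linear_span_image[OF linP, symmetric])
      also have "P ` B = insert (P b) (P ` (B - {b}))" using b(1) by blast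
      also have "P b = 0" using b(2) by (simp add: P_def)
      finally show "z \<in> span (P ` (B - {b}))" by (simp add: span_insert_0)
    qed
    have "card (P ` (B - {b})) < card B"
      using less.prems(1) b by (meson card_Diff1_less card_image_le finite_Diff le_less_trans)
    then obtain n f w where e: "\<And>x. S' x = (\<Sum>i<(n::nat). blinfun_apply (f i) x *\<^sub>R w i)"
      using less.hyps[OF _ _ sub] less.prems(1) by blast
    define f' where "f' = f(n := (1 / g y) *\<^sub>R (g o\<^sub>L S))"
    define w' where "w' = w(n := y)"
    have "S x = (\<Sum>i<Suc n. f' i x *\<^sub>R w' i)" for x
    proof -
      have "(\<Sum>i<n. f' i x *\<^sub>R w' i) = S' x" by (simp add: f'_def w'_def e)
      then show ?thesis by (simp add: f'_def w'_def S' blinfun.scaleR_left)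
    qed
    then show ?thesis by blast
  qed
qed

section \<open>Means on continuous functions\<close>

abbreviation continuous_functions :: "'a topology \<Rightarrow> ('a \<Rightarrow> real) set" where
  "continuous_functions T \<equiv> {f. continuous_map T euclideanreal f}"

text \<open>
  A mean is a positive normalized functional: the bound by constants, applied to a function and to its
  negative, puts the value between the infimum and the supremum of the function.
\<close>

definition mean_on :: "'a topology \<Rightarrow> (('a \<Rightarrow> real) \<Rightarrow> real) \<Rightarrow> bool" where
  "mean_on T L \<longleftrightarrow> linear_form_on (continuous_functions T) L \<and>
     (\<forall>f. \<forall>c. continuous_map T euclideanreal f \<longrightarrow> (\<forall>x\<in>topspace T. f x \<le> c) \<longrightarrow> L f \<le> c)"

lemma mean_on_add:
  "mean_on T L \<Longrightarrow> continuous_map T euclideanreal f \<Longrightarrow> continuous_map T euclideanreal g \<Longrightarrow>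
    L (\<lambda>x. f x + g x) = L f + L g"
  by (auto simp: mean_on_def linear_form_on_def plus_fun_def)

lemma mean_on_cmult:
  "mean_on T L \<Longrightarrow> continuous_map T euclideanreal f \<Longrightarrow> L (\<lambda>x. c * f x) = c * L f"
  by (auto simp: mean_on_def linear_form_on_def scaleR_fun_def)

lemma mean_on_le_const:
  "mean_on T L \<Longrightarrow> continuous_map T euclideanreal f \<Longrightarrow> (\<And>x. x \<in> topspace T \<Longrightarrow> f x \<le> c) \<Longrightarrow> L f \<le> c"
  by (auto simp: mean_on_def)

lemma mean_on_mono:
  assumes L: "mean_on T L" and f: "continuous_map T euclideanreal f"
    and g: "continuous_map T euclideanreal g" and le: "\<And>x. x \<in> topspace T \<Longrightarrow> f x \<le> g x"
  shows "L f \<le> L g"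
proof -
  have g': "continuous_map T euclideanreal (\<lambda>x. (-1) * g x)"
    using g by (intro continuous_intros) auto
  have "L (\<lambda>x. f x + (-1) * g x) \<le> 0"
    using f g' le by (intro mean_on_le_const[OF L]) (auto intro!: continuous_intros)
  also have "L (\<lambda>x. f x + (-1) * g x) = L f - L g"
    using mean_on_add[OF L f g'] mean_on_cmult[OF L g, of "-1"] by simp
  finally show ?thesis by simp
qed

lemma mean_on_const:
  assumes L: "mean_on T L"
  shows "L (\<lambda>x. c) = c"
proof (rule antisym)
  show "L (\<lambda>x. c) \<le> c" by (rule mean_on_le_const[OF L]) auto
  have "L (\<lambda>x. (-1) * c) \<le> - c" by (rule mean_on_le_const[OF L]) auto
  then show "c \<le> L (\<lambda>x. c)" using mean_on_cmult[OF L, of "\<lambda>x. c" "-1"] by simp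
qed

lemma mean_on_sum:
  assumes L: "mean_on T L" and "finite I" "\<And>i. i \<in> I \<Longrightarrow> continuous_map T euclideanreal (f i)"
  shows "L (\<lambda>x. \<Sum>i\<in>I. f i x) = (\<Sum>i\<in>I. L (f i))"
  using assms(2,3)
proof (induction I rule: finite_induct)
  case empty
  then show ?case using mean_on_const[OF L, of 0] by simp
next
  case (insert i I)
  have "L (\<lambda>x. f i x + (\<Sum>i\<in>I. f i x)) = L (f i) + L (\<lambda>x. \<Sum>i\<in>I. f i x)"
    using insert by (intro mean_on_add[OF L]) (auto intro!: continuous_map_sum)
  then show ?case using insert by simp
qed

lemma mean_on_max_min:
  assumes L: "mean_on T L" and f: "continuous_map T euclideanreal f"
    and g: "continuous_map T euclideanreal g"
  shows "L (\<lambda>x. max (f x) (g x)) + L (\<lambda>x. min (f x) (g x)) = L f + L g"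
proof -
  have "L (\<lambda>x. max (f x) (g x)) + L (\<lambda>x. min (f x) (g x)) = L (\<lambda>x. max (f x) (g x) + min (f x) (g x))"
    using f g by (intro mean_on_add[OF L, symmetric] continuous_intros)
  also have "(\<lambda>x. max (f x) (g x) + min (f x) (g x)) = (\<lambda>x. f x + g x)" by (auto simp: fun_eq_iff)
  finally show ?thesis using mean_on_add[OF L f g] by simp
qed

text \<open>
  If every member of a convex family reaches \<open>c\<close> somewhere, then a single mean gives all of them a value of at
  least \<open>c\<close>. The sublinear functional here is the supremum over the compact space.
\<close>

lemma minimax_mean:
  assumes T: "compact_space T" and H: "H \<noteq> {}" "\<And>h. h \<in> H \<Longrightarrow> continuous_map T euclideanreal h"
    and large: "\<And>h. h \<in> H \<Longrightarrow> \<exists>x\<in>topspace T. c \<le> h x"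
    and convex: "\<And>h1 h2 t. h1 \<in> H \<Longrightarrow> h2 \<in> H \<Longrightarrow> 0 \<le> t \<Longrightarrow> t \<le> 1 \<Longrightarrow>
        \<exists>h\<in>H. \<forall>x\<in>topspace T. h x \<le> t * h1 x + (1 - t) * h2 x"
  obtains L where "mean_on T L" "\<And>h. h \<in> H \<Longrightarrow> c \<le> L h"
proof -
  let ?V = "continuous_functions T"
  have ne: "topspace T \<noteq> {}" using H(1) large by blast
  define p where "p = (\<lambda>g::'a \<Rightarrow> real. SUP x\<in>topspace T. g x)"
  have bdd: "bdd_above (g ` topspace T)" if "g \<in> ?V" for g
  proof -
    have "compactin euclideanreal (g ` topspace T)"
      using T that image_compactin[of T "topspace T" euclideanreal g] by (simp add: compact_space_def)
    then show ?thesis by (simp add: compact_imp_bounded bounded_imp_bdd_above)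
  qed
  have p_upper: "g x \<le> p g" if "g \<in> ?V" "x \<in> topspace T" for g x
    using cSUP_upper[OF that(2) bdd[OF that(1)]] by (simp add: p_def)
  have p_least: "p g \<le> b" if "\<And>x. x \<in> topspace T \<Longrightarrow> g x \<le> b" for g b
    unfolding p_def using ne that by (intro cSUP_least) auto
  have V: "subspace ?V"
    by (auto simp: subspace_def zero_fun_def plus_fun_def scaleR_fun_def intro!: continuous_intros)
  have pV: "sublinear_on ?V p"
    unfolding sublinear_on_def
  proof (intro conjI ballI allI impI)
    fix f g assume "f \<in> ?V" "g \<in> ?V"
    then show "p (f + g) \<le> p f + p g" by (intro p_least) (auto intro!: add_mono p_upper)
  next
    fix f and t :: real assume f: "f \<in> ?V" and t: "0 \<le> t"
    have tf: "t *\<^sub>R f \<in> ?V" using V f by (simp add: subspace_scale del: mem_Collect_eq)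
    show "p (t *\<^sub>R f) = t * p f"
    proof (rule antisym)
      show "p (t *\<^sub>R f) \<le> t * p f"
        using f t by (intro p_least) (auto intro!: mult_left_mono p_upper)
      show "t * p f \<le> p (t *\<^sub>R f)"
      proof (cases "t = 0")
        case True
        obtain x where "x \<in> topspace T" using ne by blast
        then show ?thesis using p_upper[OF tf, of x] True by simp
      next
        case False
        then have "p f \<le> p (t *\<^sub>R f) / t"
          using t p_upper[OF tf] by (intro p_least) (auto simp: field_simps)
        then show ?thesis using False t by (simp add: field_simps)
      qed
    qed
  qed
  have cp: "\<forall>h\<in>H. c \<le> p h"
  proof
    fix h assume h: "h \<in> H"
    obtain x where "x \<in> topspace T" "c \<le> h x" using large[OF h] by auto
    then show "c \<le> p h" using p_upper[of h x] H(2)[OF h] by simp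
  qed
  have conv: "\<exists>h\<in>H. \<forall>g\<in>?V. p (g + (s + t) *\<^sub>R h) \<le> p (g + s *\<^sub>R h1 + t *\<^sub>R h2)"
    if h: "h1 \<in> H" "h2 \<in> H" "0 \<le> s" "0 \<le> t" for h1 h2 s t
  proof (cases "s + t = 0")
    case True
    then have "s = 0" "t = 0" using that by auto
    then show ?thesis using that by auto
  next
    case False
    then have st: "0 < s + t" using h by simp
    obtain h where hh: "h \<in> H"
      "\<And>x. x \<in> topspace T \<Longrightarrow> h x \<le> s / (s + t) * h1 x + (1 - s / (s + t)) * h2 x"
      using convex[of h1 h2 "s / (s + t)"] h st by (auto simp: field_simps)
    have le: "(s + t) * h x \<le> s * h1 x + t * h2 x" if "x \<in> topspace T" for x
    proof -
      have "(s + t) * h x \<le> (s + t) * (s / (s + t) * h1 x + (1 - s / (s + t)) * h2 x)"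
        using hh(2)[OF that] st by (intro mult_left_mono) auto
      also have "\<dots> = s * h1 x + t * h2 x"
        using st by (simp add: divide_simps)
      finally show ?thesis .
    qed
    have "p (g + (s + t) *\<^sub>R h) \<le> p (g + s *\<^sub>R h1 + t *\<^sub>R h2)" if g: "g \<in> ?V" for g
    proof (rule p_least)
      fix x assume x: "x \<in> topspace T"
      have "g + s *\<^sub>R h1 + t *\<^sub>R h2 \<in> ?V"
        using H(2)[OF h(1)] H(2)[OF h(2)] g
        by (intro subspace_add[OF V] subspace_scale[OF V]) simp_all
      then have "(g + s *\<^sub>R h1 + t *\<^sub>R h2) x \<le> p (g + s *\<^sub>R h1 + t *\<^sub>R h2)" using x by (rule p_upper)
      then show "(g + (s + t) *\<^sub>R h) x \<le> p (g + s *\<^sub>R h1 + t *\<^sub>R h2)" using le[OF x] by simp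
    qed
    then show ?thesis using hh(1) by auto
  qed
  have HV: "H \<subseteq> ?V" using H(2) by auto
  have conv': "\<forall>h1\<in>H. \<forall>h2\<in>H. \<forall>s\<ge>0. \<forall>t\<ge>0.
      \<exists>h\<in>H. \<forall>g\<in>?V. p (g + (s + t) *\<^sub>R h) \<le> p (g + s *\<^sub>R h1 + t *\<^sub>R h2)"
    using conv by blast
  obtain L where L: "linear_form_on ?V L" "\<And>x. x \<in> ?V \<Longrightarrow> L x \<le> p x" "\<And>h. h \<in> H \<Longrightarrow> c \<le> L h"
    using Mazur_Orlicz[OF V pV HV H(1) cp conv'] by blast
  have "mean_on T L"
    unfolding mean_on_def
  proof (intro conjI allI impI)
    fix f c assume "continuous_map T euclideanreal f" and "\<forall>x\<in>topspace T. f x \<le> c"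
    then show "L f \<le> c" using L(2)[of f] p_least[of f c] by simp
  qed (rule L(1))
  then show ?thesis using L(3) that by blast
qed

lemma Dini_decreasing:
  fixes h :: "nat \<Rightarrow> 'a \<Rightarrow> real"
  assumes T: "compact_space T" and h: "\<And>n. continuous_map T euclideanreal (h n)"
    and dec: "\<And>n x. x \<in> topspace T \<Longrightarrow> h (Suc n) x \<le> h n x"
    and lim: "\<And>x. x \<in> topspace T \<Longrightarrow> \<exists>n. h n x < e"
  shows "\<exists>n. \<forall>x\<in>topspace T. h n x < e"
proof (rule ccontr)
  assume "\<not> ?thesis"
  then have ne: "{x \<in> topspace T. h n x \<in> {e..}} \<noteq> {}" for n by (force simp: not_less)
  have "(\<Inter>n. {x \<in> topspace T. h n x \<in> {e..}}) \<noteq> {}"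
  proof (rule compact_space_imp_nest[OF T])
    show "closedin T {x \<in> topspace T. h n x \<in> {e..}}" for n
      by (rule closedin_continuous_map_preimage[OF h]) auto
    show "decseq (\<lambda>n. {x \<in> topspace T. h n x \<in> {e..}})"
      using dec by (intro decseq_SucI) (auto intro: order_trans)
  qed (rule ne)
  then obtain x where "x \<in> topspace T" "\<And>n. e \<le> h n x" by auto
  then show False using lim[of x] by (auto simp: not_less[symmetric])
qed

text \<open>
  Means have the monotone continuity of integrals. The functions \<open>D n\<close> may be discontinuous because the norm
  distances to which the lemma is applied are only lower semicontinuous for the weak topology; what is
  estimated is their lower integral. If the claim fails, let \<open>s n > d\<close> be the lower integral of \<open>D n\<close>, choose
  nearly optimal continuous \<open>g n\<close> below \<open>D n\<close> and put \<open>h n = min (g 0) \<dots> (g n)\<close>. The maximum of \<open>h n\<close> and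
  \<open>g (Suc n)\<close> is still below \<open>D n\<close>, hence has mean at most \<open>s n\<close>, so that passing to the minimum
  costs only the small defect of \<open>g (Suc n)\<close>. The means of \<open>h n\<close> thus stay above \<open>d / 2\<close>, although \<open>h n\<close>
  decreases to something nonpositive, which contradicts Dini's theorem.
\<close>

lemma mean_on_Daniell:
  fixes D :: "nat \<Rightarrow> 'a \<Rightarrow> real"
  assumes T: "compact_space T" and L: "mean_on T L"
    and dec: "\<And>n x. x \<in> topspace T \<Longrightarrow> D (Suc n) x \<le> D n x"
    and bound: "\<And>x. x \<in> topspace T \<Longrightarrow> D 0 x \<le> b"
    and lim: "\<And>x e. x \<in> topspace T \<Longrightarrow> 0 < e \<Longrightarrow> \<exists>n. D n x < e"
    and d: "0 < d"
  shows "\<exists>n. \<forall>g. continuous_map T euclideanreal g \<longrightarrow> (\<forall>x\<in>topspace T. g x \<le> D n x) \<longrightarrow> L g \<le> d"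
proof (rule ccontr)
  assume neg: "\<not> ?thesis"
  define G where "G = (\<lambda>n. {g. continuous_map T euclideanreal g \<and> (\<forall>x\<in>topspace T. g x \<le> D n x)})"
  have ex: "\<exists>g\<in>G n. d < L g" for n using neg by (force simp: G_def not_le)
  have Db: "D n x \<le> b" if "x \<in> topspace T" for n x
    by (induction n) (use bound[OF that] dec[OF that] in \<open>auto intro: order_trans\<close>)
  define s where "s = (\<lambda>n. SUP g\<in>G n. L g)"
  have "L g \<le> b" if "g \<in> G n" for g n
    using that Db by (intro mean_on_le_const[OF L]) (auto simp: G_def intro: order_trans)
  then have bdd: "bdd_above (L ` G n)" for n by (intro bdd_aboveI2) auto
  have s_upper: "L g \<le> s n" if "g \<in> G n" for g n
    unfolding s_def by (rule cSUP_upper[OF that bdd])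
  have ds: "d < s n" for n using ex[of n] s_upper[of _ n] by force
  \<comment> \<open>The defects sum up to \<open>d / 2\<close>.\<close>
  have "\<exists>g\<in>G n. s n - d / 2 ^ (n + 2) < L g" for n
  proof -
    have "s n - d / 2 ^ (n + 2) < s n" using d by simp
    moreover have "G n \<noteq> {}" using ex[of n] by auto
    ultimately show ?thesis using less_cSUP_iff[OF _ bdd, of n] by (auto simp: s_def)
  qed
  then obtain g where g: "\<And>n. g n \<in> G n" "\<And>n. s n - d / 2 ^ (n + 2) < L (g n)" by metis
  define h where "h = rec_nat (g 0) (\<lambda>n f x. min (f x) (g (Suc n) x))"
  have h0: "h 0 = g 0" and hS: "h (Suc n) = (\<lambda>x. min (h n x) (g (Suc n) x))" for n
    by (auto simp: h_def)
  have gc: "continuous_map T euclideanreal (g n)" for n using g(1)[of n] by (simp add: G_def)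
  have hc: "continuous_map T euclideanreal (h n)" for n
    by (induction n) (auto simp: h0 hS gc intro!: continuous_intros)
  have hg: "h n x \<le> g n x" for n x by (cases n) (auto simp: h0 hS)
  have hD: "h n x \<le> D n x" if "x \<in> topspace T" for n x
    using hg[of n x] g(1)[of n] that by (force simp: G_def)
  have Lh: "s n - d / 2 + d / 2 ^ (n + 2) \<le> L (h n)" for n
  proof (induction n)
    case 0
    then show ?case using g(2)[of 0] by (simp add: h0)
  next
    case (Suc n)
    have "g (Suc n) x \<le> D n x" if "x \<in> topspace T" for x
      using g(1)[of "Suc n"] dec[OF that, of n] that by (force simp: G_def)
    then have "(\<lambda>x. max (h n x) (g (Suc n) x)) \<in> G n"
      using hD hc gc by (auto simp: G_def intro!: continuous_intros)
    then have "L (\<lambda>x. max (h n x) (g (Suc n) x)) \<le> s n" by (rule s_upper)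
    then have "L (h n) + L (g (Suc n)) - s n \<le> L (h (Suc n))"
      using mean_on_max_min[OF L hc gc, of n "Suc n"] by (simp add: hS)
    moreover have "d / 2 ^ (n + 2) = 2 * (d / 2 ^ (Suc n + 2))" by simp
    ultimately show ?case using Suc g(2)[of "Suc n"] by linarith
  qed
  have "\<exists>n. h n x < d / 2" if "x \<in> topspace T" for x
    using lim[OF that, of "d / 2"] d hD[OF that] by (meson half_gt_zero le_less_trans)
  then have "\<exists>n. \<forall>x\<in>topspace T. h n x < d / 2"
    by (intro Dini_decreasing[OF T hc]) (auto simp: hS)
  then obtain n where n: "\<And>x. x \<in> topspace T \<Longrightarrow> h n x < d / 2" by blast
  then have "L (h n) \<le> d / 2" by (intro mean_on_le_const[OF L hc]) (auto intro: less_imp_le)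
  moreover have "0 < d / 2 ^ (n + 2)" using d by simp
  ultimately show False using Lh[of n] ds[of n] by simp
qed

section \<open>Tightness of means on weakly compact sets\<close>

lemma topspace_weak_topology [simp]: "topspace weak_topology = UNIV"
proof -
  have "blinfun_apply 0 -` UNIV \<in> {blinfun_apply x' -` U | (x' :: 'a \<Rightarrow>\<^sub>L real) U. open U}" by blast
  then show ?thesis unfolding weak_topology_def topology_generated_by_topspace by auto
qed

lemma continuous_map_weak_topology [continuous_intros]:
  "continuous_map weak_topology euclideanreal (blinfun_apply x')"
proof -
  have "openin weak_topology (blinfun_apply x' -` U)" if "open U" for U
    unfolding weak_topology_def using that by (intro topology_generated_by_Basis) blast
  then show ?thesis by (auto simp: continuous_map_def vimage_def)
qed

lemma continuous_map_subtopology_weak [continuous_intros]: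
  "continuous_map (subtopology weak_topology W) euclideanreal (blinfun_apply x')"
  by (intro continuous_map_from_subtopology continuous_intros)

lemma continuous_map_MIN:
  assumes "finite I" "I \<noteq> {}" "\<And>i. i \<in> I \<Longrightarrow> continuous_map T euclideanreal (f i)"
  shows "continuous_map T euclideanreal (\<lambda>x. MIN i\<in>I. f i x)"
  using assms
proof (induction I rule: finite_ne_induct)
  case (insert i I)
  then have "continuous_map T euclideanreal (\<lambda>x. min (f i x) (MIN i\<in>I. f i x))"
    by (intro continuous_map_real_min) auto
  then show ?case using insert by simp
qed auto

lemma continuous_map_MAX:
  assumes "finite I" "I \<noteq> {}" "\<And>i. i \<in> I \<Longrightarrow> continuous_map T euclideanreal (f i)"
  shows "continuous_map T euclideanreal (\<lambda>x. MAX i\<in>I. f i x)"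
  using assms
proof (induction I rule: finite_ne_induct)
  case (insert i I)
  then have "continuous_map T euclideanreal (\<lambda>x. max (f i x) (MAX i\<in>I. f i x))"
    by (intro continuous_map_real_max) auto
  then show ?case using insert by simp
qed auto

text \<open>
  For \<open>F\<close> in the dual unit ball this is a weakly continuous lower bound of the norm distance to \<open>A\<close>, and the
  norm distance is the supremum of these functions over all finite \<open>F\<close>.
\<close>

definition functional_dist :: "'x::real_normed_vector set \<Rightarrow> ('x \<Rightarrow>\<^sub>L real) set \<Rightarrow> 'x \<Rightarrow> real" where
  "functional_dist A F w = (MIN a\<in>A. MAX f\<in>F. \<bar>blinfun_apply f w - blinfun_apply f a\<bar>)"

lemma continuous_map_functional_dist:
  assumes "finite A" "A \<noteq> {}" "finite F" "F \<noteq> {}"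
  shows "continuous_map (subtopology weak_topology W) euclideanreal (functional_dist A F)"
  unfolding functional_dist_def using assms
  by (intro continuous_map_MIN continuous_map_MAX continuous_intros) auto

lemma functional_dist_mono:
  assumes "finite A" "A \<noteq> {}" "finite F'" "F \<noteq> {}" "F \<subseteq> F'"
  shows "functional_dist A F w \<le> functional_dist A F' w"
proof -
  have "(MIN a\<in>A. MAX f\<in>F. \<bar>blinfun_apply f w - blinfun_apply f a\<bar>) \<le> (MAX f\<in>F'. \<bar>blinfun_apply f w - blinfun_apply f a\<bar>)" if "a \<in> A" for a
  proof -
    have "(MIN a\<in>A. MAX f\<in>F. \<bar>blinfun_apply f w - blinfun_apply f a\<bar>) \<le> (MAX f\<in>F. \<bar>blinfun_apply f w - blinfun_apply f a\<bar>)"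
      using assms that by (intro Min_le) auto
    also have "\<dots> \<le> (MAX f\<in>F'. \<bar>blinfun_apply f w - blinfun_apply f a\<bar>)" using assms by (intro Max_mono) auto
    finally show ?thesis .
  qed
  then show ?thesis unfolding functional_dist_def using assms by (intro Min.boundedI) auto
qed

lemma functional_dist_le:
  assumes "finite A" "a \<in> A" "finite F" "F \<noteq> {}" "\<And>f. f \<in> F \<Longrightarrow> \<bar>blinfun_apply f w - blinfun_apply f a\<bar> \<le> c"
  shows "functional_dist A F w \<le> c"
proof -
  have "functional_dist A F w \<le> (MAX f\<in>F. \<bar>blinfun_apply f w - blinfun_apply f a\<bar>)"
    unfolding functional_dist_def using assms by (intro Min_le) auto
  also have "\<dots> \<le> c" using assms by (subst Max_le_iff) auto
  finally show ?thesis .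
qed

lemma weakly_compact_finite_net:
  fixes W :: "'x::real_normed_vector set" and F :: "('x \<Rightarrow>\<^sub>L real) set"
  assumes W: "compactin weak_topology W" and F: "finite F" and e: "0 < e"
  obtains A where "finite A" "A \<subseteq> W" "\<And>w. w \<in> W \<Longrightarrow> \<exists>a\<in>A. \<forall>f\<in>F. \<bar>blinfun_apply f w - f a\<bar> < e"
proof -
  let ?dev = "\<lambda>a v. MAX f\<in>insert 0 F. \<bar>blinfun_apply f v - blinfun_apply f a\<bar>"
  define U where "U = (\<lambda>a. {v \<in> topspace weak_topology. ?dev a v \<in> {..<e}})"
  have mem: "v \<in> U a \<longleftrightarrow> (\<forall>f\<in>F. \<bar>f v - f a\<bar> < e)" for v a
    using F e by (auto simp: U_def)
  have "openin weak_topology (U a)" for a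
    unfolding U_def using F
    by (intro openin_continuous_map_preimage[of _ euclideanreal] continuous_map_MAX continuous_intros) auto
  moreover have "W \<subseteq> \<Union>(U ` W)" using e mem by fastforce
  ultimately obtain \<F> where \<F>: "finite \<F>" "\<F> \<subseteq> U ` W" "W \<subseteq> \<Union>\<F>"
    using W unfolding compactin_def by (smt (verit) imageE)
  then obtain A where A: "A \<subseteq> W" "finite A" "\<F> = U ` A" by (meson finite_subset_image)
  have "\<exists>a\<in>A. \<forall>f\<in>F. \<bar>blinfun_apply f w - f a\<bar> < e" if "w \<in> W" for w
    using that A \<F> mem by blast
  with A that show ?thesis by blast
qed

text \<open>
  The hypotheses say that \<open>w\<close> is a limit of points of the sets \<open>A n\<close> for the topology given by the countably many
  functionals in the sets \<open>F n\<close>, and that the \<open>A n\<close> absorb convex combinations up to small errors. Let \<open>s\<close> be the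
  supremum seminorm of these functionals. If the convex combinations kept a positive \<open>s\<close>-distance from \<open>w\<close>, a
  functional \<open>g\<close> below \<open>s\<close> would separate them from \<open>w\<close>. By weak compactness the approximating points cluster at
  some \<open>v \<in> W\<close>. All functionals in the \<open>F n\<close> agree at \<open>v\<close> and \<open>w\<close>, hence \<open>s (w - v) = 0\<close> and
  \<open>g w \<le> g v\<close>; but \<open>g\<close> is weakly continuous, so it still separates \<open>v\<close> from \<open>w\<close>.
\<close>

lemma weakly_dense_convex_combinations:
  fixes W :: "'x::real_normed_vector set" and F :: "nat \<Rightarrow> ('x \<Rightarrow>\<^sub>L real) set"
  assumes W: "compactin weak_topology W" and w: "w \<in> W" and e: "0 < e"
    and A: "incseq A" and F: "incseq F" "\<And>n. finite (F n)" "\<And>n f. f \<in> F n \<Longrightarrow> norm f \<le> 1" "F 0 \<noteq> {}"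
    and net: "\<And>n w. w \<in> W \<Longrightarrow> \<exists>a\<in>A (Suc n) \<inter> W. \<forall>f\<in>F n. \<bar>blinfun_apply f w - f a\<bar> < 1 / real (Suc n)"
    and hull: "\<And>n c. c \<in> convex hull (A n) \<Longrightarrow> \<exists>a\<in>A (Suc n). norm (c - a) < 1 / real (Suc n)"
  shows "\<exists>n. \<exists>a\<in>A n. \<forall>m. \<forall>f\<in>F m. \<bar>blinfun_apply f w - f a\<bar> \<le> e"
proof -
  define C where "C = (\<Union>n. convex hull (A n))"
  have hull_mono: "convex hull (A m) \<subseteq> convex hull (A n)" if "m \<le> n" for m n
    using A that by (intro hull_mono) (auto simp: incseq_def)
  have "convex C"
  proof (rule convexI)
    fix x y and u v :: real assume xy: "x \<in> C" "y \<in> C" and uv: "0 \<le> u" "0 \<le> v" "u + v = 1"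
    from xy obtain m n where "x \<in> convex hull (A m)" "y \<in> convex hull (A n)" by (auto simp: C_def)
    then have "x \<in> convex hull (A (max m n))" "y \<in> convex hull (A (max m n))"
      using hull_mono[of m "max m n"] hull_mono[of n "max m n"] by auto
    then have "u *\<^sub>R x + v *\<^sub>R y \<in> convex hull (A (max m n))"
      using uv by (intro convexD[OF convex_convex_hull])
    then show "u *\<^sub>R x + v *\<^sub>R y \<in> C" by (auto simp: C_def)
  qed
  have AC: "a \<in> C" if "a \<in> A n" for a n using that hull_inc[of a "A n"] by (auto simp: C_def)
  define FF where "FF = (\<Union>n. F n)"
  have FF: "norm f \<le> 1" if "f \<in> FF" for f using that F by (auto simp: FF_def)
  have FFne: "FF \<noteq> {}" using F(4) by (auto simp: FF_def)
  define s where "s = (\<lambda>x. SUP f\<in>FF. \<bar>blinfun_apply f x\<bar>)"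
  have le_norm: "\<bar>f x\<bar> \<le> norm x" if "f \<in> FF" for f and x :: 'x
    using norm_blinfun[of f x] FF[OF that] mult_right_mono[of "norm f" 1 "norm x"] by simp
  have bdd: "bdd_above ((\<lambda>f. \<bar>blinfun_apply f x\<bar>) ` FF)" for x
    using le_norm by (intro bdd_aboveI2)
  have s_upper: "\<bar>f x\<bar> \<le> s x" if "f \<in> FF" for f x
    unfolding s_def by (rule cSUP_upper[OF that bdd])
  have s_least: "s x \<le> b" if "\<And>f. f \<in> FF \<Longrightarrow> \<bar>f x\<bar> \<le> b" for x b
    unfolding s_def using FFne that by (intro cSUP_least)
  have s_add: "s (x + y) \<le> s x + s y" for x y
  proof (rule s_least)
    fix f assume "f \<in> FF"
    then show "\<bar>f (x + y)\<bar> \<le> s x + s y"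
      using s_upper[of f x] s_upper[of f y] by (auto simp: blinfun.add_right)
  qed
  have s_scale: "s (t *\<^sub>R x) = t * s x" if t: "0 \<le> t" for t x
  proof (rule antisym)
    show "s (t *\<^sub>R x) \<le> t * s x"
      using t by (intro s_least) (auto simp: blinfun.scaleR_right abs_mult intro!: mult_left_mono s_upper)
    show "t * s x \<le> s (t *\<^sub>R x)"
    proof (cases "t = 0")
      case True
      obtain f where "f \<in> FF" using FFne by auto
      then show ?thesis using s_upper[of f "t *\<^sub>R x"] True by simp
    next
      case False
      then have "s x \<le> s (t *\<^sub>R x) / t"
        using t s_upper[of _ "t *\<^sub>R x"] by (intro s_least) (auto simp: field_simps blinfun.scaleR_right abs_mult)
      then show ?thesis using False t by (simp add: field_simps)
    qed
  qed
  have "\<exists>c\<in>C. s (w - c) < e / 2"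
  proof (rule ccontr)
    assume "\<not> ?thesis"
    then have far: "e / 2 \<le> s h" if "h \<in> (\<lambda>c. w - c) ` C" for h using that by (force simp: not_less)
    have "A (Suc 0) \<noteq> {}" using net[OF w, of 0] by auto
    then have ne: "(\<lambda>c. w - c) ` C \<noteq> {}" using AC by auto
    have "(\<lambda>c. w - c) ` C = (\<lambda>c. w + c) ` (\<lambda>c. - c) ` C" by (auto simp: image_image)
    then have conv: "convex ((\<lambda>c. w - c) ` C)"
      using \<open>convex C\<close> by (auto intro!: convex_translation convex_negations)
    have s_norm: "s x \<le> norm x" for x by (intro s_least le_norm)
    have "\<exists>g :: 'x \<Rightarrow>\<^sub>L real. (\<forall>x. g x \<le> s x) \<and> (\<forall>h\<in>(\<lambda>c. w - c) ` C. e / 2 \<le> g h)"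
      by (rule seminorm_dominated_functional[OF s_add s_scale s_norm conv ne far]) blast+
    then obtain g :: "'x \<Rightarrow>\<^sub>L real" where g: "\<And>x. g x \<le> s x"
      "\<And>h. h \<in> (\<lambda>c. w - c) ` C \<Longrightarrow> e / 2 \<le> g h" by blast
    let ?T = "subtopology weak_topology W"
    \<comment> \<open>The zero functional keeps the maximum nonempty and does not change the condition.\<close>
    define K where "K = (\<lambda>n. {v \<in> topspace ?T. g v \<in> {..g w - e / 2}} \<inter>
      {v \<in> topspace ?T. (MAX f\<in>insert 0 (F n). \<bar>blinfun_apply f v - blinfun_apply f w\<bar>) \<in> {..1 / real (Suc n)}})"
    have K_iff: "v \<in> K n \<longleftrightarrow> v \<in> W \<and> g v \<le> g w - e / 2 \<and> (\<forall>f\<in>F n. \<bar>f v - f w\<bar> \<le> 1 / real (Suc n))" for v n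
      using F(2)[of n] by (auto simp: K_def)
    have "(\<Inter>n. K n) \<noteq> {}"
    proof (rule compact_space_imp_nest)
      show "compact_space ?T" using W by (simp add: compact_space_subtopology)
      show "closedin ?T (K n)" for n
        unfolding K_def using F(2)
        by (intro closedin_Int closedin_continuous_map_preimage[of _ euclideanreal] continuous_map_MAX continuous_intros) auto
      show "decseq K"
      proof (rule decseq_SucI, rule subsetI)
        fix n v assume v: "v \<in> K (Suc n)"
        have "1 / real (Suc (Suc n)) \<le> 1 / real (Suc n)" by (simp add: field_simps)
        moreover have "F n \<subseteq> F (Suc n)" using F(1) by (simp add: incseq_SucD)
        ultimately show "v \<in> K n" using v unfolding K_iff by (meson order_trans subsetD)
      qed
      show "K n \<noteq> {}" for n
      proof -
        obtain a where a: "a \<in> A (Suc n)" "a \<in> W" "\<forall>f\<in>F n. \<bar>blinfun_apply f w - f a\<bar> < 1 / real (Suc n)"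
          using net[OF w, of n] by auto
        have "g a \<le> g w - e / 2" using g(2)[of "w - a"] AC[OF a(1)] by (auto simp: blinfun.diff_right)
        then have "a \<in> K n" using a by (auto simp: K_iff abs_minus_commute less_imp_le)
        then show ?thesis by auto
      qed
    qed
    then obtain v where v: "\<And>n. v \<in> K n" by auto
    have "f v = f w" if f: "f \<in> F m" for f m
    proof -
      have "\<bar>f v - f w\<bar> \<le> d" if d: "0 < d" for d
      proof -
        obtain k where k: "1 / real (Suc k) < d" using nat_approx_posE[OF d] by auto
        have "1 / real (Suc (max m k)) \<le> 1 / real (Suc k)" by (simp add: field_simps)
        moreover have "f \<in> F (max m k)" using f F(1) by (meson incseqD max.cobounded1 subsetD)
        ultimately show ?thesis using v[of "max m k"] k by (auto simp: K_iff intro: order_trans)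
      qed
      then have "\<bar>f v - f w\<bar> \<le> 0" by (rule field_le_epsilon[of _ 0, simplified])
      then show ?thesis by simp
    qed
    then have "s (w - v) \<le> 0" by (intro s_least) (auto simp: FF_def blinfun.diff_right)
    then have "g (w - v) \<le> 0" using g(1) order_trans by blast
    then show False using v[of 0] e by (auto simp: K_iff blinfun.diff_right)
  qed
  then obtain c n where c: "c \<in> convex hull (A n)" "s (w - c) < e / 2" by (auto simp: C_def)
  obtain k where k: "1 / real (Suc k) < e / 2" using nat_approx_posE[of "e / 2"] e by auto
  have "c \<in> convex hull (A (max n k))" using c(1) hull_mono[of n "max n k"] by auto
  then obtain a where a: "a \<in> A (Suc (max n k))" "norm (c - a) < 1 / real (Suc (max n k))" using hull by blast
  have "1 / real (Suc (max n k)) \<le> 1 / real (Suc k)" by (simp add: field_simps)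
  then have ca: "norm (c - a) < e / 2" using a(2) k by simp
  have "\<bar>blinfun_apply f w - f a\<bar> \<le> e" if "f \<in> F m" for f m
  proof -
    have f: "f \<in> FF" using that by (auto simp: FF_def)
    have "\<bar>f (w - c)\<bar> \<le> e / 2" "\<bar>f (c - a)\<bar> \<le> e / 2"
      using s_upper[OF f, of "w - c"] c(2) le_norm[OF f, of "c - a"] ca by auto
    then show ?thesis unfolding blinfun.diff_right by linarith
  qed
  with a(1) show ?thesis by blast
qed

text \<open>
  If no finite set works, one builds increasing finite sets \<open>A n\<close> and \<open>F n\<close> such that \<open>functional_dist (A n) (F n)\<close> has
  mean above \<open>d\<close>. In each step \<open>A (Suc n)\<close> receives a net of \<open>W\<close> for the functionals in \<open>F n\<close> and a norm net of the
  convex hull of \<open>A n\<close>, and \<open>F (Suc n)\<close> is then enlarged to witness the failure of \<open>A (Suc n)\<close>. For the seminorm \<open>s\<close>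
  given by all \<open>F n\<close>, the \<open>s\<close>-distances to \<open>A n\<close> decrease to zero on \<open>W\<close> by Mazur's theorem and dominate the
  functions \<open>functional_dist (A n) (F n)\<close>, which contradicts the continuity of means.
\<close>

lemma mean_on_weakly_compact_tight:
  fixes W :: "'x::real_normed_vector set"
  assumes W: "compactin weak_topology W" and bound: "\<And>w. w \<in> W \<Longrightarrow> norm w \<le> 1"
    and L: "mean_on (subtopology weak_topology W) L" and d: "0 < d"
  shows "\<exists>A. finite A \<and> A \<noteq> {} \<and>
    (\<forall>F. finite F \<longrightarrow> F \<noteq> {} \<longrightarrow> (\<forall>f\<in>F. norm f \<le> 1) \<longrightarrow> L (functional_dist A F) \<le> d)"
proof (rule ccontr)
  assume neg: "\<not> ?thesis"
  let ?T = "subtopology weak_topology W"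
  define P :: "'x set \<times> ('x \<Rightarrow>\<^sub>L real) set \<Rightarrow> bool" where
    "P = (\<lambda>(A, F). finite A \<and> A \<noteq> {} \<and> finite F \<and> F \<noteq> {} \<and> (\<forall>f\<in>F. norm f \<le> 1) \<and>
      d < L (functional_dist A F))"
  define Q :: "nat \<Rightarrow> 'x set \<times> ('x \<Rightarrow>\<^sub>L real) set \<Rightarrow> 'x set \<times> ('x \<Rightarrow>\<^sub>L real) set \<Rightarrow> bool" where
    "Q = (\<lambda>n (A, F) (A', F'). A \<subseteq> A' \<and> F \<subseteq> F' \<and>
      (\<forall>w\<in>W. \<exists>a\<in>A' \<inter> W. \<forall>f\<in>F. \<bar>blinfun_apply f w - f a\<bar> < 1 / real (Suc n)) \<and>
      (\<forall>c\<in>convex hull A. \<exists>a\<in>A'. norm (c - a) < 1 / real (Suc n)))"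
  have ext: "\<exists>F. P (A, F)" if "finite A" "A \<noteq> {}" for A
    using neg that by (auto simp: P_def not_le)
  have step: "\<exists>y. P y \<and> Q n x y" if Px: "P x" for x n
  proof -
    obtain A F where x: "x = (A, F)" by (cases x)
    have A: "finite A" "A \<noteq> {}" and F: "finite F" "F \<noteq> {}" "\<forall>f\<in>F. norm f \<le> 1"
      using Px by (auto simp: x P_def)
    have e: "0 < 1 / real (Suc n)" by simp
    obtain N where N: "finite N" "N \<subseteq> W"
      "\<And>w. w \<in> W \<Longrightarrow> \<exists>a\<in>N. \<forall>f\<in>F. \<bar>blinfun_apply f w - f a\<bar> < 1 / real (Suc n)"
      using weakly_compact_finite_net[OF W F(1) e] by blast
    have "compact (convex hull A)" by (rule finite_imp_compact_convex_hull[OF A(1)])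
    then obtain N' where N': "finite N'" "convex hull A \<subseteq> (\<Union>a\<in>N'. ball a (1 / real (Suc n)))"
      using e unfolding compact_eq_totally_bounded by blast
    define A' where "A' = A \<union> N \<union> N'"
    have A': "finite A'" "A' \<noteq> {}" using A N N' by (auto simp: A'_def)
    obtain F1 where F1: "P (A', F1)" using ext[OF A'] by auto
    have "functional_dist A' F1 w \<le> functional_dist A' (F \<union> F1) w" for w
      using A' F F1 by (intro functional_dist_mono) (auto simp: P_def)
    then have "L (functional_dist A' F1) \<le> L (functional_dist A' (F \<union> F1))"
      using A' F F1 by (intro mean_on_mono[OF L] continuous_map_functional_dist) (auto simp: P_def)
    then have "P (A', F \<union> F1)" using A' F F1 by (auto simp: P_def)
    moreover have "Q n (A, F) (A', F \<union> F1)"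
      unfolding Q_def prod.case
    proof (intro conjI ballI)
      fix w assume "w \<in> W"
      then show "\<exists>a\<in>A' \<inter> W. \<forall>f\<in>F. \<bar>blinfun_apply f w - f a\<bar> < 1 / real (Suc n)"
        using N(2) N(3)[of w] by (auto simp: A'_def)
    next
      fix c assume "c \<in> convex hull A"
      then obtain a where "a \<in> N'" "dist a c < 1 / real (Suc n)" using N'(2) by auto
      then show "\<exists>a\<in>A'. norm (c - a) < 1 / real (Suc n)"
        by (intro bexI[of _ a]) (auto simp: A'_def dist_norm norm_minus_commute)
    qed (auto simp: A'_def)
    ultimately show ?thesis unfolding x by blast
  qed
  have base: "\<exists>x. P x" using ext[of "{0}"] by blast
  have "\<exists>p. \<forall>n. P (p n) \<and> Q n (p n) (p (Suc n))"
    by (rule dependent_nat_choice[where P = "\<lambda>_. P"]) (use base step in blast)+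
  then obtain p where p: "\<And>n. P (p n)" "\<And>n. Q n (p n) (p (Suc n))" by blast
  define A where "A = (\<lambda>n. fst (p n))"
  define F where "F = (\<lambda>n. snd (p n))"
  have p_eq: "p n = (A n, F n)" for n by (simp add: A_def F_def)
  have PA: "finite (A n)" "A n \<noteq> {}" "finite (F n)" "F n \<noteq> {}" "\<And>f. f \<in> F n \<Longrightarrow> norm f \<le> 1"
    "d < L (functional_dist (A n) (F n))" for n
    using p(1)[of n] by (auto simp: p_eq P_def)
  have Q': "A n \<subseteq> A (Suc n) \<and> F n \<subseteq> F (Suc n) \<and>
      (\<forall>w\<in>W. \<exists>a\<in>A (Suc n) \<inter> W. \<forall>f\<in>F n. \<bar>blinfun_apply f w - f a\<bar> < 1 / real (Suc n)) \<and>
      (\<forall>c\<in>convex hull (A n). \<exists>a\<in>A (Suc n). norm (c - a) < 1 / real (Suc n))" for n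
    using p(2)[of n] unfolding p_eq Q_def prod.case .
  have incA: "incseq A" by (rule incseq_SucI) (use Q' in blast)
  have incF: "incseq F" by (rule incseq_SucI) (use Q' in blast)
  have dense: "\<exists>n. \<exists>a\<in>A n. \<forall>m. \<forall>f\<in>F m. \<bar>blinfun_apply f w - f a\<bar> \<le> e" if "w \<in> W" "0 < e" for w e
    using Q' PA by (intro weakly_dense_convex_combinations[OF W that incA incF]) blast+
  define FF where "FF = (\<Union>n. F n)"
  have FFne: "FF \<noteq> {}" using PA(4) by (auto simp: FF_def)
  define s where "s = (\<lambda>x. SUP f\<in>FF. \<bar>blinfun_apply f x\<bar>)"
  have le_norm: "\<bar>blinfun_apply f x\<bar> \<le> norm x" if "f \<in> FF" for f x
    using norm_blinfun[of f x] PA(5)[of f] that mult_right_mono[of "norm f" 1 "norm x"]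
    by (auto simp: FF_def)
  have s_upper: "\<bar>blinfun_apply f x\<bar> \<le> s x" if "f \<in> FF" for f x
    unfolding s_def using le_norm by (intro cSUP_upper[OF that] bdd_aboveI2)
  have s_least: "s x \<le> b" if "\<And>f. f \<in> FF \<Longrightarrow> \<bar>blinfun_apply f x\<bar> \<le> b" for x b
    unfolding s_def using FFne that by (intro cSUP_least)
  define D where "D = (\<lambda>n w. MIN a\<in>A n. s (w - a))"
  have D_le: "D n w \<le> s (w - a)" if "a \<in> A n" for n w a
    unfolding D_def using PA(1) that by (intro Min_le) auto
  obtain a0 where a0: "a0 \<in> A 0" using PA(2) by blast
  have "\<exists>n. \<forall>g. continuous_map ?T euclideanreal g \<longrightarrow> (\<forall>w\<in>topspace ?T. g w \<le> D n w) \<longrightarrow> L g \<le> d"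
  proof (rule mean_on_Daniell[OF _ L _ _ _ d])
    show "compact_space ?T" using W by (simp add: compact_space_subtopology)
    show "D (Suc n) w \<le> D n w" for n w
      unfolding D_def using PA(1,2) Q'[of n] by (intro Min_antimono) auto
    show "D 0 w \<le> 1 + norm a0" if "w \<in> topspace ?T" for w
    proof -
      have "D 0 w \<le> s (w - a0)" by (rule D_le[OF a0])
      also have "\<dots> \<le> norm (w - a0)" by (intro s_least le_norm)
      also have "\<dots> \<le> norm w + norm a0" by (rule norm_triangle_ineq4)
      finally show ?thesis using bound[of w] that by simp
    qed
    show "\<exists>n. D n w < e" if "w \<in> topspace ?T" "0 < e" for w e
    proof -
      have "w \<in> W" "0 < e / 2" using that by auto
      from dense[OF this] obtain n a where a: "a \<in> A n"
        "\<And>m f. f \<in> F m \<Longrightarrow> \<bar>blinfun_apply f w - f a\<bar> \<le> e / 2" by blast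
      have "s (w - a) \<le> e / 2"
        using a(2) by (intro s_least) (auto simp: FF_def blinfun.diff_right)
      then have "D n w < e" using D_le[OF a(1), of w] that(2) by simp
      then show ?thesis ..
    qed
  qed
  then obtain n where n: "\<forall>g. continuous_map ?T euclideanreal g \<longrightarrow>
      (\<forall>w\<in>topspace ?T. g w \<le> D n w) \<longrightarrow> L g \<le> d" ..
  have "functional_dist (A n) (F n) w \<le> D n w" for w
  proof -
    have "functional_dist (A n) (F n) w \<le> s (w - a)" if "a \<in> A n" for a
    proof (rule functional_dist_le[OF PA(1) that PA(3,4)])
      fix f assume "f \<in> F n"
      then have "f \<in> FF" by (auto simp: FF_def)
      then show "\<bar>blinfun_apply f w - blinfun_apply f a\<bar> \<le> s (w - a)"
        using s_upper[of f "w - a"] by (simp add: blinfun.diff_right)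
    qed
    then show ?thesis unfolding D_def using PA(1,2) by (intro Min.boundedI) auto
  qed
  then have "L (functional_dist (A n) (F n)) \<le> d"
    using n continuous_map_functional_dist[of "A n" "F n" W] PA(1-4) by simp
  then show False using PA(6)[of n] by simp
qed

lemma compact_insert_zero_Union:
  fixes U :: "nat \<Rightarrow> 'x::real_normed_vector set"
  assumes fin: "\<And>k. finite (U k)" and small: "\<And>k x. x \<in> U k \<Longrightarrow> norm x \<le> r k" and r: "r \<longlonglongrightarrow> 0"
  shows "compact (insert 0 (\<Union>k. U k))"
proof (rule compactI)
  fix C assume C: "\<forall>t\<in>C. open t" "insert 0 (\<Union>k. U k) \<subseteq> \<Union>C"
  then obtain B where B: "B \<in> C" "0 \<in> B" "open B" by auto
  obtain \<delta> where \<delta>: "0 < \<delta>" "ball 0 \<delta> \<subseteq> B" using B by (meson openE)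
  obtain N where N: "\<And>k. k \<ge> N \<Longrightarrow> norm (r k - 0) < \<delta>" using LIMSEQ_D[OF r \<delta>(1)] by blast
  have tail: "x \<in> B" if "x \<in> U k" "N \<le> k" for x k
    using N[OF that(2)] small[OF that(1)] \<delta>(2) by auto
  have head: "compact (\<Union>k<N. U k)" using fin by (intro finite_imp_compact) auto
  have "(\<Union>k<N. U k) \<subseteq> \<Union>C" using C(2) by blast
  then obtain C' where C': "C' \<subseteq> C" "finite C'" "(\<Union>k<N. U k) \<subseteq> \<Union>C'"
    using C(1) compactE[OF head] by metis
  have "insert 0 (\<Union>k. U k) \<subseteq> \<Union>(insert B C')"
  proof
    fix x assume "x \<in> insert 0 (\<Union>k. U k)"
    then consider "x = 0" | k where "x \<in> U k" "k < N" | k where "x \<in> U k" "N \<le> k"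
      by (metis UN_E insertE not_less)
    then show "x \<in> \<Union>(insert B C')" using C'(3) tail B(2) by cases auto
  qed
  then show "\<exists>C'\<subseteq>C. finite C' \<and> insert 0 (\<Union>k. U k) \<subseteq> \<Union>C'"
    using C' B(1) by (intro exI[of _ "insert B C'"]) auto
qed

lemma continuous_map_norm_finite_rank:
  fixes S :: "'x::real_normed_vector \<Rightarrow>\<^sub>L 'y::real_normed_vector"
  assumes "finite_rank S"
  shows "continuous_map (subtopology weak_topology W) euclideanreal (\<lambda>w. norm (S w))"
proof -
  obtain n f y where S: "\<And>x. S x = (\<Sum>i<(n::nat). blinfun_apply (f i) x *\<^sub>R y i)"
    using assms finite_rank_expansion unfolding finite_rank_def by metis
  have "continuous_map (subtopology weak_topology W) euclidean (\<lambda>w. blinfun_apply (f i) w *\<^sub>R y i)" for i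
  proof -
    have "continuous_map (subtopology weak_topology W) euclidean ((\<lambda>r. r *\<^sub>R y i) \<circ> blinfun_apply (f i))"
      by (rule continuous_map_compose[OF continuous_map_subtopology_weak])
        (auto simp: continuous_map_iff_continuous2 intro!: continuous_intros)
    then show ?thesis by (simp add: o_def)
  qed
  then show ?thesis unfolding S by (intro continuous_intros) auto
qed

section \<open>Finite rank operators that contract a weakly compact set\<close>

text \<open>
  At a fixed point the weakly continuous lower bounds of the distances are exact for a suitable finite set of
  functionals, namely those norming the finitely many differences to the points of the \<open>A k\<close>.
\<close>

lemma norming_functionals_finite:
  fixes A :: "nat \<Rightarrow> 'x::real_normed_vector set"
  assumes "\<And>k. finite (A k)" "\<And>k. A k \<noteq> {}"
  shows "\<exists>F :: ('x \<Rightarrow>\<^sub>L real) set. (finite F \<and> F \<noteq> {} \<and> (\<forall>f\<in>F. norm f \<le> 1)) \<and>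
    (\<forall>k\<le>N. (MIN a\<in>A k. norm (w - a)) \<le> functional_dist (A k) F w)"
proof -
  have "\<forall>x::'x. \<exists>f :: 'x \<Rightarrow>\<^sub>L real. norm f \<le> 1 \<and> blinfun_apply f x = norm x"
    using norming_functional by metis
  then obtain \<phi> :: "'x \<Rightarrow> 'x \<Rightarrow>\<^sub>L real" where \<phi>: "\<And>x. norm (\<phi> x) \<le> 1" "\<And>x. blinfun_apply (\<phi> x) x = norm x" by metis
  define F where "F = insert 0 (\<Union>k\<le>N. (\<lambda>a. \<phi> (w - a)) ` A k)"
  have F: "finite F" "F \<noteq> {}" using assms by (auto simp: F_def)
  have "(MIN a\<in>A k. norm (w - a)) \<le> functional_dist (A k) F w" if k: "k \<le> N" for k
    unfolding functional_dist_def
  proof (rule Min.boundedI)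
    fix y assume "y \<in> (\<lambda>a. MAX f\<in>F. \<bar>blinfun_apply f w - blinfun_apply f a\<bar>) ` A k"
    then obtain a where a: "a \<in> A k" "y = (MAX f\<in>F. \<bar>blinfun_apply f w - blinfun_apply f a\<bar>)" by auto
    have "(MIN a\<in>A k. norm (w - a)) \<le> norm (w - a)" using assms a by (intro Min_le) auto
    also have "\<dots> = \<bar>\<phi> (w - a) w - \<phi> (w - a) a\<bar>" using \<phi>(2)[of "w - a"] by (simp add: blinfun.diff_right)
    also have "\<dots> \<le> y" unfolding a(2) using F a(1) k by (intro Max_ge) (auto simp: F_def)
    finally show "(MIN a\<in>A k. norm (w - a)) \<le> y" .
  qed (use assms in auto)
  moreover have "norm f \<le> 1" if "f \<in> F" for f using that \<phi>(1) by (auto simp: F_def)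
  ultimately show ?thesis using F by blast
qed

text \<open>
  With \<open>a k\<close> a nearest point of \<open>A k\<close>, one has \<open>a 0 = 0\<close> and \<open>w\<close> is the sum of the differences \<open>a (Suc k) - a k\<close>
  for \<open>k < N\<close> and of \<open>w - a N\<close>. Only the last term is estimated by the norm of \<open>R\<close>.
\<close>

lemma telescoping_bound:
  fixes R :: "'x::real_normed_vector \<Rightarrow>\<^sub>L 'y::real_normed_vector"
  assumes A: "\<And>k. finite (A k)" "\<And>k. A k \<noteq> {}" "A 0 = {0}" and e: "0 \<le> e"
    and R: "\<And>k a b. a \<in> A (Suc k) \<Longrightarrow> b \<in> A k \<Longrightarrow> norm (R (a - b)) \<le> e * 2 ^ k * norm (a - b)"
  defines "\<delta> \<equiv> \<lambda>k w. MIN a\<in>A k. norm (w - a)"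
  shows "norm (R w) \<le> (\<Sum>k<N. e * 2 ^ k * (\<delta> (Suc k) w + \<delta> k w)) + norm R * \<delta> N w"
proof -
  have "\<exists>a\<in>A k. norm (w - a) = \<delta> k w" for k
  proof -
    have "\<delta> k w \<in> (\<lambda>a. norm (w - a)) ` A k" unfolding \<delta>_def using A by (intro Min_in) auto
    then show ?thesis by auto
  qed
  then obtain a where a: "\<And>k. a k \<in> A k" "\<And>k. norm (w - a k) = \<delta> k w" by metis
  have a0: "a 0 = 0" using a(1)[of 0] A(3) by simp
  have "norm (R w) \<le> (\<Sum>k<N. e * 2 ^ k * (\<delta> (Suc k) w + \<delta> k w)) + norm (R (w - a N))" for N
  proof (induction N)
    case (Suc N)
    have "norm (a (Suc N) - a N) = norm ((w - a N) - (w - a (Suc N)))" by simp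
    also have "\<dots> \<le> \<delta> (Suc N) w + \<delta> N w"
      using norm_triangle_ineq4[of "w - a N" "w - a (Suc N)"] a(2) by simp
    finally have "e * 2 ^ N * norm (a (Suc N) - a N) \<le> e * 2 ^ N * (\<delta> (Suc N) w + \<delta> N w)"
      using e by (intro mult_left_mono) simp_all
    with R[OF a(1) a(1), of N]
    have "norm (R (a (Suc N) - a N)) \<le> e * 2 ^ N * (\<delta> (Suc N) w + \<delta> N w)" by (rule order_trans)
    moreover have "R (w - a N) = R (w - a (Suc N)) + R (a (Suc N) - a N)"
      by (simp add: blinfun.diff_right)
    ultimately show ?case
      using Suc norm_triangle_ineq[of "R (w - a (Suc N))" "R (a (Suc N) - a N)"] by simp
  qed (simp add: a0)
  moreover have "norm (R (w - a N)) \<le> norm R * \<delta> N w" using norm_blinfun[of R "w - a N"] a(2) by simp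
  ultimately show ?thesis by (meson add_left_mono order_trans)
qed

text \<open>
  The \<open>A k\<close> are chosen with mean distance at most $8^{-k}$, starting with \<open>A 0 = {0}\<close>. The vectors \<open>(1/2) ^ k *\<^sub>R sgn (a - b)\<close> with
  \<open>a \<in> A (Suc k)\<close> and \<open>b \<in> A k\<close> form, together with zero, a norm compact set. An \<open>S\<close> that is \<open>e\<close>-close to the
  identity there moves \<open>a - b\<close> by at most \<open>e * 2 ^ k * norm (a - b)\<close>, and this growth is beaten by $8^{-k}$: the
  telescoping bound has mean at most $e\sum_k 2^k(8^{-k-1}+8^{-k}) = \frac32 e$ plus the mean of the last term, which
  becomes small when \<open>N\<close> is chosen after \<open>S\<close>.
\<close>

lemma finite_rank_small_mean:
  fixes W :: "'x::real_normed_vector set"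
  assumes AP: "approximation_property TYPE('x)"
    and W: "compactin weak_topology W" and bound: "\<And>w. w \<in> W \<Longrightarrow> norm w \<le> 1"
    and L: "mean_on (subtopology weak_topology W) L" and E: "finite E" and e: "0 < e"
  shows "\<exists>S :: 'x \<Rightarrow>\<^sub>L 'x. finite_rank S \<and> (\<forall>x\<in>E. norm (S x - x) \<le> e) \<and> L (\<lambda>w. norm (S w)) \<le> 1 + 4 * e"
proof -
  let ?T = "subtopology weak_topology W"
  let ?ball = "\<lambda>F :: ('x \<Rightarrow>\<^sub>L real) set. finite F \<and> F \<noteq> {} \<and> (\<forall>f\<in>F. norm f \<le> 1)"
  have T: "compact_space ?T" using W by (simp add: compact_space_subtopology)
  have dist0: "functional_dist {0} F w \<le> 1" if F: "?ball F" and w: "w \<in> W" for F w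
  proof (rule functional_dist_le[of _ 0])
    fix f :: "'x \<Rightarrow>\<^sub>L real" assume "f \<in> F"
    then have "norm f * norm w \<le> 1 * 1" using F bound[OF w] by (intro mult_mono) auto
    then show "\<bar>blinfun_apply f w - blinfun_apply f 0\<bar> \<le> 1" using norm_blinfun[of f w] by simp
  qed (use F in auto)
  have "\<exists>A. finite A \<and> A \<noteq> {} \<and> (\<forall>F. ?ball F \<longrightarrow> L (functional_dist A F) \<le> (1/8) ^ k) \<and> (k = 0 \<longrightarrow> A = {0})" for k
  proof (cases k)
    case 0
    have "L (functional_dist {0} F) \<le> 1" if "?ball F" for F
      using that dist0[OF that] by (intro mean_on_le_const[OF L] continuous_map_functional_dist) auto
    then show ?thesis using 0 by (intro exI[of _ "{0}"]) auto
  next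
    case (Suc j)
    have "0 < (1/8 :: real) ^ k" by simp
    from mean_on_weakly_compact_tight[OF W bound L this]
    show ?thesis using Suc by auto
  qed
  then obtain A where A: "\<And>k. finite (A k)" "\<And>k. A k \<noteq> {}" "A 0 = {0}"
    and A_small: "\<And>k F. ?ball F \<Longrightarrow> L (functional_dist (A k) F) \<le> (1/8) ^ k" by metis
  define U where "U = (\<lambda>k. (\<lambda>(a, b). (1/2) ^ k *\<^sub>R sgn (a - b)) ` (A (Suc k) \<times> A k))"
  define K where "K = E \<union> insert 0 (\<Union>k. U k)"
  have "compact K"
    unfolding K_def
  proof (intro compact_Un finite_imp_compact[OF E] compact_insert_zero_Union)
    show "finite (U k)" for k using A(1) by (simp add: U_def)
    show "norm x \<le> (1/2) ^ k" if "x \<in> U k" for x k using that by (auto simp: U_def norm_sgn)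
    show "(\<lambda>k. (1/2) ^ k :: real) \<longlonglongrightarrow> 0" by (intro LIMSEQ_power_zero) auto
  qed
  from AP[unfolded approximation_property_def, rule_format, OF e this]
  obtain S :: "'x \<Rightarrow>\<^sub>L 'x" where S: "finite_rank S" "\<And>x. x \<in> K \<Longrightarrow> norm (S x - x) \<le> e" by blast
  define R where "R = S - id_blinfun"
  have R: "R x = S x - x" for x by (simp add: R_def blinfun.diff_left)
  have R_diff: "norm (R (a - b)) \<le> e * 2 ^ k * norm (a - b)" if "a \<in> A (Suc k)" "b \<in> A k" for k a b
  proof -
    have "(1/2) ^ k *\<^sub>R sgn (a - b) \<in> U k" using that by (force simp: U_def)
    then have "norm (R ((1/2) ^ k *\<^sub>R sgn (a - b))) \<le> e" using S(2) by (auto simp: K_def R)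
    then have le: "(1/2) ^ k * norm (R (sgn (a - b))) \<le> e" by (simp add: blinfun.scaleR_right)
    have "a - b = norm (a - b) *\<^sub>R sgn (a - b)" by (cases "a = b") (auto simp: sgn_div_norm)
    then have "R (a - b) = norm (a - b) *\<^sub>R R (sgn (a - b))" by (metis blinfun.scaleR_right)
    then have "norm (R (a - b)) = 2 ^ k * norm (a - b) * ((1/2) ^ k * norm (R (sgn (a - b))))"
      by (simp add: power_one_over)
    also have "\<dots> \<le> 2 ^ k * norm (a - b) * e" using le by (intro mult_left_mono) auto
    finally show ?thesis by (simp add: mult_ac)
  qed
  \<comment> \<open>The norm of \<open>R\<close> is not under control in advance, so \<open>N\<close> depends on \<open>S\<close>.\<close>
  obtain N where N: "(1/8) ^ N < e / (norm R + 1)"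
    using real_arch_pow_inv[of "e / (norm R + 1)" "1/8"] e by (auto simp: add_nonneg_pos)
  have N': "norm R * (1/8) ^ N \<le> e"
  proof -
    have "norm R * (1/8) ^ N \<le> (norm R + 1) * (1/8) ^ N" by (intro mult_right_mono) auto
    also have "\<dots> \<le> e"
      using N less_divide_eq[of "(1/8) ^ N" e "norm R + 1"] by (simp add: add_nonneg_pos mult.commute)
    finally show ?thesis .
  qed
  let ?G = "\<lambda>F k. functional_dist (A k) F"
  \<comment> \<open>The telescoping bound with the distances replaced by their weakly continuous lower bounds. The additional \<open>e\<close>
    makes the inequality strict, so that by compactness one finite \<open>F\<close> serves all of \<open>W\<close>.\<close>
  define H where "H = (\<lambda>F w. (1 + e) + ((\<Sum>k<N. e * 2 ^ k * (?G F (Suc k) w + ?G F k w)) + norm R * ?G F N w))"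
  have cG: "continuous_map ?T euclideanreal (?G F k)" if "?ball F" for F k
    using that A by (intro continuous_map_functional_dist) auto
  have cH: "continuous_map ?T euclideanreal (H F)" if "?ball F" for F
    unfolding H_def
    by (intro continuous_map_add continuous_map_sum continuous_map_real_mult_left cG[OF that]) simp_all
  have cS: "continuous_map ?T euclideanreal (\<lambda>w. norm (S w))" by (rule continuous_map_norm_finite_rank[OF S(1)])
  have H_mono: "H F w \<le> H F' w" if "?ball F" "?ball F'" "F \<subseteq> F'" for F F' w
  proof -
    have G: "?G F k w \<le> ?G F' k w" for k using that by (intro functional_dist_mono A) simp_all
    show ?thesis
      unfolding H_def using e by (intro add_left_mono add_mono sum_mono mult_left_mono G) simp_all
  qed
  have "\<forall>w\<in>W. \<exists>F. ?ball F \<and> norm (S w) < H F w"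
  proof
    fix w assume w: "w \<in> W"
    from norming_functionals_finite[of A N w, OF A(1,2)]
    obtain F where F0: "?ball F \<and> (\<forall>k\<le>N. (MIN a\<in>A k. norm (w - a)) \<le> ?G F k w)" ..
    note F' = conjunct1[OF F0]
    have F: "(MIN a\<in>A k. norm (w - a)) \<le> ?G F k w" if "k \<le> N" for k using F0 that by simp
    have "norm (S w) = norm (w + R w)" by (simp add: R)
    also have "\<dots> \<le> 1 + norm (R w)" using norm_triangle_ineq[of w "R w"] bound[OF w] by simp
    also have "\<dots> < (1 + e) + norm (R w)" using e by simp
    also have "\<dots> \<le> (1 + e) + ((\<Sum>k<N. e * 2 ^ k * ((MIN a\<in>A (Suc k). norm (w - a)) + (MIN a\<in>A k. norm (w - a))))
        + norm R * (MIN a\<in>A N. norm (w - a)))"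
      using e by (intro add_left_mono telescoping_bound A R_diff) simp_all
    also have "\<dots> \<le> H F w"
      unfolding H_def using e by (intro add_left_mono add_mono sum_mono mult_left_mono F) simp_all
    finally have "?ball F \<and> norm (S w) < H F w" using F' by (rule conjI[rotated])
    then show "\<exists>F. ?ball F \<and> norm (S w) < H F w" by (rule exI[where x = F])
  qed
  from bchoice[OF this] obtain \<Phi> where
    "\<forall>w\<in>W. ?ball (\<Phi> w) \<and> norm (S w) < H (\<Phi> w) w" ..
  then have \<Phi>: "?ball (\<Phi> w)" "norm (S w) < H (\<Phi> w) w" if "w \<in> W" for w using that by simp_all
  define O' where "O' = (\<lambda>w. {v \<in> topspace ?T. H (\<Phi> w) v - norm (S v) \<in> {0<..}})"
  have "openin ?T (O' w)" if "w \<in> W" for w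
    unfolding O'_def
    by (rule openin_continuous_map_preimage[OF continuous_map_diff[OF cH[OF \<Phi>(1)[OF that]] cS]]) simp
  moreover have "topspace ?T \<subseteq> \<Union>(O' ` W)" using \<Phi>(2) by (auto simp: O'_def)
  ultimately obtain \<O> where \<O>: "finite \<O>" "\<O> \<subseteq> O' ` W" "topspace ?T \<subseteq> \<Union>\<O>"
    using compactinD[of ?T "topspace ?T" "O' ` W"] T unfolding compact_space_def by auto
  then obtain V where V: "V \<subseteq> W" "finite V" "\<O> = O' ` V" by (meson finite_subset_image)
  define F where "F = insert 0 (\<Union>v\<in>V. \<Phi> v)"
  have F: "?ball F" using V \<Phi>(1) by (auto simp: F_def)
  have SH: "norm (S w) \<le> H F w" if w: "w \<in> topspace ?T" for w
  proof -
    obtain v where v: "v \<in> V" "w \<in> O' v" using \<O>(3) V(3) w by auto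
    have "norm (S w) \<le> H (\<Phi> v) w" using v(2) by (simp add: O'_def)
    also have "\<dots> \<le> H F w" using v V F \<Phi>(1)[of v] by (intro H_mono) (auto simp: F_def)
    finally show ?thesis .
  qed
  \<comment> \<open>The bound of the mean of \<open>g k\<close> is written as a difference so that the sum over \<open>k\<close> telescopes.\<close>
  define g where "g = (\<lambda>k w. e * 2 ^ k * (?G F (Suc k) w + ?G F k w))"
  have cGs: "continuous_map ?T euclideanreal (\<lambda>w. ?G F (Suc k) w + ?G F k w)" for k
    by (intro continuous_map_add cG[OF F])
  have cg: "continuous_map ?T euclideanreal (g k)" for k
    unfolding g_def by (intro continuous_map_real_mult_left cGs)
  have Lg: "L (g k) \<le> e * (3/2 * (1/4) ^ k - 3/2 * (1/4) ^ Suc k)" for k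
  proof -
    have "L (g k) = e * 2 ^ k * (L (?G F (Suc k)) + L (?G F k))"
      unfolding g_def mean_on_cmult[OF L cGs] mean_on_add[OF L cG[OF F] cG[OF F]] ..
    also have "\<dots> \<le> e * 2 ^ k * ((1/8) ^ Suc k + (1/8) ^ k)"
      using e by (intro mult_left_mono add_mono A_small[OF F]) simp_all
    also have "\<dots> = e * (2 ^ k * (1/8) ^ k) * (9/8)" by (simp add: algebra_simps)
    also have "2 ^ k * (1/8) ^ k = (1/4 :: real) ^ k" by (simp flip: power_mult_distrib)
    also have "e * (1/4) ^ k * (9/8) = e * (3/2 * (1/4) ^ k - 3/2 * (1/4) ^ Suc k)" by (simp add: algebra_simps)
    finally show ?thesis .
  qed
  have "L (\<lambda>w. norm (S w)) \<le> L (H F)" using cS cH[OF F] SH by (rule mean_on_mono[OF L])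
  also have "L (H F) = (1 + e) + ((\<Sum>k<N. L (g k)) + norm R * L (?G F N))"
  proof -
    have c1: "continuous_map ?T euclideanreal (\<lambda>w. \<Sum>k<N. g k w)"
      by (intro continuous_map_sum cg) simp
    have c2: "continuous_map ?T euclideanreal (\<lambda>w. norm R * ?G F N w)"
      by (intro continuous_map_real_mult_left cG[OF F])
    have H_eq: "H F = (\<lambda>w. (1 + e) + ((\<Sum>k<N. g k w) + norm R * ?G F N w))"
      unfolding H_def g_def ..
    have "L (H F) = L (\<lambda>w. 1 + e) + L (\<lambda>w. (\<Sum>k<N. g k w) + norm R * ?G F N w)"
      unfolding H_eq by (rule mean_on_add[OF L _ continuous_map_add[OF c1 c2]]) simp
    also have "\<dots> = (1 + e) + (L (\<lambda>w. \<Sum>k<N. g k w) + L (\<lambda>w. norm R * ?G F N w))"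
      by (simp only: mean_on_const[OF L] mean_on_add[OF L c1 c2])
    also have "L (\<lambda>w. \<Sum>k<N. g k w) = (\<Sum>k<N. L (g k))"
      by (rule mean_on_sum[OF L]) (simp_all add: cg)
    also have "L (\<lambda>w. norm R * ?G F N w) = norm R * L (?G F N)"
      by (rule mean_on_cmult[OF L cG[OF F]])
    finally show ?thesis .
  qed
  also have "\<dots> \<le> (1 + e) + ((\<Sum>k<N. e * (3/2 * (1/4) ^ k - 3/2 * (1/4) ^ Suc k)) + e)"
  proof -
    have "norm R * L (?G F N) \<le> norm R * (1/8) ^ N" by (intro mult_left_mono A_small[OF F]) simp
    also have "\<dots> \<le> e" by (rule N')
    finally show ?thesis by (intro add_left_mono add_mono sum_mono Lg)
  qed
  also have "(\<Sum>k<N. e * (3/2 * (1/4) ^ k - 3/2 * (1/4) ^ Suc k)) = e * (3/2 - 3/2 * (1/4) ^ N)"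
    unfolding sum_distrib_left[symmetric] sum_lessThan_telescope'[of "\<lambda>k. 3/2 * (1/4::real) ^ k"] by simp
  also have "(1 + e) + (e * (3/2 - 3/2 * (1/4) ^ N) + e) \<le> 1 + 4 * e"
    using e by (simp add: algebra_simps)
  finally show ?thesis using S by (auto simp: K_def)
qed

lemma finite_rank_convex_combination:
  fixes S1 S2 :: "'x::real_normed_vector \<Rightarrow>\<^sub>L 'y::real_normed_vector"
  assumes "finite_rank S1" "finite_rank S2"
  shows "finite_rank (s *\<^sub>R S1 + t *\<^sub>R S2)"
proof -
  obtain B1 B2 where B: "finite B1" "range (blinfun_apply S1) \<subseteq> span B1"
      "finite B2" "range (blinfun_apply S2) \<subseteq> span B2"
    using assms unfolding finite_rank_def by blast
  have "s *\<^sub>R S1 x + t *\<^sub>R S2 x \<in> span (B1 \<union> B2)" for x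
  proof (intro span_add span_scale)
    show "S1 x \<in> span (B1 \<union> B2)" "S2 x \<in> span (B1 \<union> B2)"
      using B(2,4) span_mono[of B1 "B1 \<union> B2"] span_mono[of B2 "B1 \<union> B2"] by auto
  qed
  then show ?thesis unfolding finite_rank_def using B(1,3)
    by (intro exI[of _ "B1 \<union> B2"]) (auto simp: blinfun.add_left blinfun.scaleR_left)
qed

text \<open>
  The minimax argument: if all admissible \<open>S\<close> were large somewhere on \<open>W\<close>, some mean would see all of them as large,
  whereas each mean admits an \<open>S\<close> of small mean.
\<close>

lemma finite_rank_almost_contraction:
  fixes W E :: "'x::real_normed_vector set"
  assumes AP: "approximation_property TYPE('x)"
    and W: "compactin weak_topology W" and bound: "\<And>w. w \<in> W \<Longrightarrow> norm w \<le> 1"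
    and E: "finite E" and e: "0 < e"
  shows "\<exists>S :: 'x \<Rightarrow>\<^sub>L 'x. finite_rank S \<and> (\<forall>x\<in>E. norm (S x - x) \<le> e) \<and> (\<forall>w\<in>W. norm (S w) < 1 + 5 * e)"
proof (rule ccontr)
  assume neg: "\<not> ?thesis"
  let ?T = "subtopology weak_topology W"
  define C where "C = {S :: 'x \<Rightarrow>\<^sub>L 'x. finite_rank S \<and> (\<forall>x\<in>E. norm (S x - x) \<le> e)}"
  define H where "H = (\<lambda>S w. norm (blinfun_apply S w)) ` C"
  have T: "compact_space ?T" using W by (simp add: compact_space_subtopology)
  from AP[unfolded approximation_property_def, rule_format, OF e finite_imp_compact[OF E]]
  have ne: "H \<noteq> {}" by (auto simp: H_def C_def)
  have cont: "continuous_map ?T euclideanreal h" if "h \<in> H" for h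
    using that continuous_map_norm_finite_rank by (auto simp: H_def C_def)
  have large: "\<exists>w\<in>topspace ?T. 1 + 5 * e \<le> h w" if "h \<in> H" for h
    using that neg by (force simp: H_def C_def not_less)
  have conv: "\<exists>h\<in>H. \<forall>w\<in>topspace ?T. h w \<le> t * h1 w + (1 - t) * h2 w"
    if h: "h1 \<in> H" "h2 \<in> H" and t: "0 \<le> t" "t \<le> 1" for h1 h2 t
  proof -
    obtain S1 S2 where S: "S1 \<in> C" "S2 \<in> C" "h1 = (\<lambda>w. norm (S1 w))" "h2 = (\<lambda>w. norm (S2 w))"
      using h by (auto simp: H_def)
    define S where "S = t *\<^sub>R S1 + (1 - t) *\<^sub>R S2"
    have S_apply: "S x = t *\<^sub>R S1 x + (1 - t) *\<^sub>R S2 x" for x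
      by (simp add: S_def blinfun.add_left blinfun.scaleR_left)
    have combine: "norm (t *\<^sub>R a + (1 - t) *\<^sub>R b) \<le> t * norm a + (1 - t) * norm b" for a b :: 'x
      using norm_triangle_ineq[of "t *\<^sub>R a" "(1 - t) *\<^sub>R b"] t by simp
    have "norm (S x - x) \<le> e" if "x \<in> E" for x
    proof -
      have "S x - x = t *\<^sub>R (S1 x - x) + (1 - t) *\<^sub>R (S2 x - x)" by (simp add: S_apply algebra_simps)
      then have "norm (S x - x) \<le> t * norm (S1 x - x) + (1 - t) * norm (S2 x - x)" using combine by simp
      also have "\<dots> \<le> t * e + (1 - t) * e"
        using S(1,2) that t by (intro add_mono mult_left_mono) (auto simp: C_def)
      finally show ?thesis by (simp add: algebra_simps)
    qed
    then have "S \<in> C" using S(1,2) by (auto simp: C_def S_def intro: finite_rank_convex_combination)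
    then have "(\<lambda>w. norm (S w)) \<in> H" by (simp add: H_def)
    then show ?thesis by (rule bexI[rotated]) (simp add: S(3,4) S_apply combine)
  qed
  obtain L where L: "mean_on ?T L" "\<And>h. h \<in> H \<Longrightarrow> 1 + 5 * e \<le> L h"
    by (rule minimax_mean[OF T ne cont large conv]) blast+
  obtain S where "S \<in> C" "L (\<lambda>w. norm (S w)) \<le> 1 + 4 * e"
    using finite_rank_small_mean[OF AP W bound L(1) E e] by (auto simp: C_def)
  then show False using L(2)[of "\<lambda>w. norm (S w)"] e by (auto simp: H_def)
qed

text \<open>
  The bound \<open>1 + 5 * d\<close> on \<open>W\<close> is brought down to \<open>1\<close> by scaling, which moves a point \<open>x\<close> of \<open>E\<close> by at most
  \<open>5 * d * norm x\<close> more.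
\<close>

lemma finite_rank_contraction_on_weakly_compact:
  fixes W E :: "'x::real_normed_vector set"
  assumes AP: "approximation_property TYPE('x)"
    and W: "compactin weak_topology W" and bound: "\<And>w. w \<in> W \<Longrightarrow> norm w \<le> 1"
    and E: "finite E" and e: "0 < e"
  shows "\<exists>S :: 'x \<Rightarrow>\<^sub>L 'x. finite_rank S \<and> (\<forall>x\<in>E. norm (S x - x) \<le> e) \<and> (\<forall>w\<in>W. norm (S w) \<le> 1)"
proof -
  define b where "b = 1 + (\<Sum>x\<in>E. norm x)"
  have b: "1 \<le> b" "1 + norm x \<le> b" if "x \<in> E" for x
    using member_le_sum[of x E norm] that E by (auto simp: b_def intro: sum_nonneg)
  have b1: "1 \<le> b" by (auto simp: b_def intro: sum_nonneg)
  define d where "d = e / (5 * b)"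
  have d: "0 < d" using e b1 by (simp add: d_def)
  obtain S :: "'x \<Rightarrow>\<^sub>L 'x" where S: "finite_rank S" "\<And>x. x \<in> E \<Longrightarrow> norm (S x - x) \<le> d"
      "\<And>w. w \<in> W \<Longrightarrow> norm (S w) < 1 + 5 * d"
    using finite_rank_almost_contraction[OF AP W bound E d] by blast
  define c where "c = 1 / (1 + 5 * d)"
  have c: "0 < c" "c \<le> 1" "c * (1 + 5 * d) = 1" using d by (auto simp: c_def)
  have "finite_rank (c *\<^sub>R S)" using finite_rank_convex_combination[OF S(1) S(1), of c 0] by simp
  moreover have "norm ((c *\<^sub>R S) x - x) \<le> e" if "x \<in> E" for x
  proof -
    have "(c *\<^sub>R S) x - x = c *\<^sub>R (S x - x - (5 * d) *\<^sub>R x)"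
      using c(3) by (simp add: blinfun.scaleR_left algebra_simps flip: scaleR_add_left)
    then have "norm ((c *\<^sub>R S) x - x) = c * norm (S x - x - (5 * d) *\<^sub>R x)" using c by simp
    also have "\<dots> \<le> 1 * norm (S x - x - (5 * d) *\<^sub>R x)" using c by (intro mult_right_mono) auto
    also have "\<dots> \<le> norm (S x - x) + norm ((5 * d) *\<^sub>R x)"
      using norm_triangle_ineq4[of "S x - x" "(5 * d) *\<^sub>R x"] by simp
    also have "\<dots> \<le> d + 5 * d * norm x" using S(2)[OF that] d by simp
    also have "\<dots> \<le> 5 * d * (1 + norm x)" using d by (simp add: algebra_simps)
    also have "\<dots> \<le> 5 * d * b" using b(2)[OF that] d by (intro mult_left_mono) auto
    also have "\<dots> = e" using b1 by (simp add: d_def)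
    finally show ?thesis .
  qed
  moreover have "norm ((c *\<^sub>R S) w) \<le> 1" if "w \<in> W" for w
  proof -
    have "c * norm (S w) \<le> c * (1 + 5 * d)" using S(3)[OF that] c(1) by (intro mult_left_mono) auto
    then show ?thesis using c by (simp add: blinfun.scaleR_left)
  qed
  ultimately show ?thesis by blast
qed

section \<open>Signed measures and their derivatives\<close>

lemma vector_measure_sums:
  assumes "vector_measure M m" "range A \<subseteq> sets M" "disjoint_family A"
  shows "(\<lambda>i::nat. m (A i)) sums m (\<Union>i. A i)"
  using assms by (auto simp: vector_measure_def)

lemma vector_measure_empty:
  assumes "vector_measure M m"
  shows "m {} = 0"
proof -
  have "(\<lambda>i::nat. m {}) sums m (\<Union>i::nat. {})"
    using vector_measure_sums[OF assms, of "\<lambda>i. {}"] by (auto simp: disjoint_family_on_def)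
  then show ?thesis using sums_summable summable_const_iff by blast
qed

lemma vector_measure_Un:
  assumes m: "vector_measure M m" and AB: "A \<in> sets M" "B \<in> sets M" "A \<inter> B = {}"
  shows "m (A \<union> B) = m A + m B"
proof -
  have "disjoint_family (binaryset A B)"
    using AB(3) by (auto simp: disjoint_family_on_def binaryset_def)
  then have "(\<lambda>n. m (binaryset A B n)) sums m (\<Union>n. binaryset A B n)"
    using AB by (intro vector_measure_sums[OF m]) (auto simp: range_binaryset_eq)
  moreover have "(\<lambda>n. m (binaryset A B n)) sums (m A + m B)"
    by (rule binaryset_sums) (rule vector_measure_empty[OF m])
  ultimately show ?thesis by (simp add: UN_binaryset_eq sums_unique2)
qed

lemma vector_measure_split:
  assumes m: "vector_measure M m" and "A \<in> sets M" "B \<in> sets M"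
  shows "m A = m (A \<inter> B) + m (A - B)"
proof -
  have "m ((A \<inter> B) \<union> (A - B)) = m (A \<inter> B) + m (A - B)"
    using assms(2,3) by (intro vector_measure_Un[OF m]) auto
  then show ?thesis by (simp add: Int_Diff_Un)
qed

lemma vector_measure_scalar:
  assumes "vector_measure M m"
  shows "vector_measure M (scalar_measure m x')"
  unfolding vector_measure_def scalar_measure_def
proof (intro allI impI)
  fix A :: "nat \<Rightarrow> 'a set" assume "range A \<subseteq> sets M" "disjoint_family A"
  then have "(\<lambda>i. m (A i)) sums m (\<Union>i. A i)" by (rule vector_measure_sums[OF assms])
  then show "(\<lambda>i. x' (m (A i))) sums x' (m (\<Union>i. A i))"
    by (rule bounded_linear.sums[OF blinfun.bounded_linear_right])
qed

lemma vector_measure_uminus: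
  fixes \<nu> :: "'a set \<Rightarrow> 'x::real_normed_vector"
  assumes "vector_measure M \<nu>"
  shows "vector_measure M (\<lambda>A. - \<nu> A)"
  unfolding vector_measure_def
proof (intro allI impI)
  fix A :: "nat \<Rightarrow> 'a set" assume "range A \<subseteq> sets M" "disjoint_family A"
  then show "(\<lambda>i. - \<nu> (A i)) sums - \<nu> (\<Union>i. A i)"
    by (intro sums_minus vector_measure_sums[OF assms])
qed

text \<open>
  Call a set bad if the values on its measurable subsets are unbounded. A bad set is the union of two parts on
  both of which the measure has absolute value at least one, and one of the parts is bad again. Iterating
  yields disjoint sets whose measures do not tend to zero, against countable additivity.
\<close>

lemma signed_measure_bounded:
  fixes \<nu> :: "'a set \<Rightarrow> real"
  assumes \<nu>: "vector_measure M \<nu>"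
  shows "\<exists>c. \<forall>A\<in>sets M. \<bar>\<nu> A\<bar> \<le> c"
proof (rule ccontr)
  define bad where "bad = (\<lambda>E. E \<in> sets M \<and> (\<forall>c. \<exists>B\<in>sets M. B \<subseteq> E \<and> c < \<bar>\<nu> B\<bar>))"
  assume neg: "\<not> ?thesis"
  have "\<exists>B\<in>sets M. B \<subseteq> space M \<and> c < \<bar>\<nu> B\<bar>" for c
  proof -
    obtain B where "B \<in> sets M" "\<not> \<bar>\<nu> B\<bar> \<le> c" using neg by blast
    then show ?thesis by (intro bexI[of _ B]) (auto dest: sets.sets_into_space)
  qed
  then have "bad (space M)" by (simp add: bad_def)
  moreover have "\<exists>E'. bad E' \<and> E' \<subseteq> E \<and> 1 \<le> \<bar>\<nu> (E - E')\<bar>" if E: "bad E" for E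
  proof -
    obtain B where B: "B \<in> sets M" "B \<subseteq> E" "\<bar>\<nu> E\<bar> + 1 < \<bar>\<nu> B\<bar>" using E by (auto simp: bad_def)
    have EM: "E \<in> sets M" using E by (simp add: bad_def)
    have "\<nu> E = \<nu> B + \<nu> (E - B)"
      using vector_measure_split[OF \<nu> EM B(1)] B(2) by (simp add: Int_absorb1)
    then have big: "1 \<le> \<bar>\<nu> (E - B)\<bar>" "1 \<le> \<bar>\<nu> B\<bar>" using B(3) by linarith+
    have "bad B \<or> bad (E - B)"
    proof (rule ccontr)
      assume "\<not> ?thesis"
      then obtain c1 c2 where c: "\<And>C. C \<in> sets M \<Longrightarrow> C \<subseteq> B \<Longrightarrow> \<bar>\<nu> C\<bar> \<le> c1"
        "\<And>C. C \<in> sets M \<Longrightarrow> C \<subseteq> E - B \<Longrightarrow> \<bar>\<nu> C\<bar> \<le> c2"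
        using B(1) EM unfolding bad_def by (metis not_le sets.Diff)
      obtain C where C: "C \<in> sets M" "C \<subseteq> E" "c1 + c2 < \<bar>\<nu> C\<bar>" using E by (auto simp: bad_def)
      have "\<nu> C = \<nu> (C \<inter> B) + \<nu> (C - B)" by (rule vector_measure_split[OF \<nu> C(1) B(1)])
      moreover have "\<bar>\<nu> (C \<inter> B)\<bar> \<le> c1" "\<bar>\<nu> (C - B)\<bar> \<le> c2" using B(1) C(1,2) by (auto intro!: c)
      ultimately show False using C(3) by linarith
    qed
    then show ?thesis
    proof
      assume "bad B"
      then show ?thesis using B(2) big(1) by blast
    next
      assume "bad (E - B)"
      moreover have "E - (E - B) = B" using B(2) by auto
      ultimately show ?thesis using big(2) by (intro exI[of _ "E - B"]) auto
    qed
  qed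
  ultimately have "\<exists>E. \<forall>n::nat. bad (E n) \<and> (E (Suc n) \<subseteq> E n \<and> 1 \<le> \<bar>\<nu> (E n - E (Suc n))\<bar>)"
    by (intro dependent_nat_choice) auto
  then obtain E where E: "\<And>n::nat. bad (E n)"
    "\<And>n. E (Suc n) \<subseteq> E n \<and> 1 \<le> \<bar>\<nu> (E n - E (Suc n))\<bar>" by metis
  have dec: "E n \<subseteq> E m" if "m \<le> n" for m n
    by (rule decseqD[OF decseq_SucI that]) (use E(2) in blast)
  have "disjoint_family (\<lambda>n. E n - E (Suc n))"
    unfolding disjoint_family_on_def
  proof (intro ballI impI)
    fix m n :: nat assume "m \<noteq> n"
    then have "Suc m \<le> n \<or> Suc n \<le> m" by auto
    then show "(E m - E (Suc m)) \<inter> (E n - E (Suc n)) = {}" using dec by blast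
  qed
  then have "(\<lambda>n. \<nu> (E n - E (Suc n))) sums \<nu> (\<Union>n. E n - E (Suc n))"
    using E(1) by (intro vector_measure_sums[OF \<nu>]) (auto simp: bad_def)
  then have "(\<lambda>n. \<nu> (E n - E (Suc n))) \<longlonglongrightarrow> 0" using sums_summable summable_LIMSEQ_zero by blast
  then have "\<exists>N. \<forall>n\<ge>N. norm (\<nu> (E n - E (Suc n)) - 0) < 1" by (rule LIMSEQ_D) simp
  then obtain n where "\<bar>\<nu> (E n - E (Suc n))\<bar> < 1" by auto
  then show False using E(2)[of n] by simp
qed

lemma ennreal_plus_le: "ennreal (x + y) \<le> ennreal x + ennreal y"
proof (cases "0 \<le> x \<and> 0 \<le> y")
  case False
  then have "x + y \<le> x \<or> x + y \<le> y" by linarith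
  then show ?thesis
    by (meson add_increasing add_increasing2 ennreal_leI order_trans order_refl zero_le)
qed (simp add: ennreal_plus)

lemma ennreal_sum_le: "ennreal (\<Sum>i\<in>I. x i) \<le> (\<Sum>i\<in>I. ennreal (x i))"
proof (induction I rule: infinite_finite_induct)
  case (insert i I)
  then show ?case using ennreal_plus_le[of "x i" "sum x I"] by (auto intro: order_trans add_mono)
qed auto

text \<open>
  Countable additivity of \<open>\<nu>\<close> bounds the value on a union by the sum of the values. For the converse, nearly
  optimal subsets of two disjoint sets are united; a subset of negative measure contributes zero to the
  truncated supremum and is replaced by the empty set.
\<close>

lemma positive_part_countably_additive:
  fixes \<nu> :: "'a set \<Rightarrow> real"
  assumes \<nu>: "vector_measure M \<nu>"
  defines "P \<equiv> \<lambda>A. SUP B \<in> {B \<in> sets M. B \<subseteq> A}. ennreal (\<nu> B)"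
  shows "countably_additive (sets M) P"
proof -
  have P_upper: "ennreal (\<nu> B) \<le> P A" if "B \<in> sets M" "B \<subseteq> A" for A B
    unfolding P_def using that by (intro SUP_upper) auto
  have P_least: "P A \<le> b" if "\<And>B. B \<in> sets M \<Longrightarrow> B \<subseteq> A \<Longrightarrow> ennreal (\<nu> B) \<le> b" for A b
    unfolding P_def using that by (intro SUP_least) auto
  have P_mono: "P A \<le> P B" if "A \<subseteq> B" for A B
    unfolding P_def using that by (intro SUP_subset_mono) auto
  have superadd: "P A + P B \<le> P (A \<union> B)" if AB: "A \<inter> B = {}" for A B
  proof -
    have ne: "{C \<in> sets M. C \<subseteq> D} \<noteq> {}" for D by auto
    have 1: "ennreal (\<nu> C) + ennreal (\<nu> D) \<le> P (A \<union> B)"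
      if CD: "C \<in> sets M" "C \<subseteq> A" "D \<in> sets M" "D \<subseteq> B" for C D
    proof -
      consider "0 \<le> \<nu> C" "0 \<le> \<nu> D" | "\<nu> C < 0" | "\<nu> D < 0" by linarith
      then show ?thesis
      proof cases
        case 1
        have "\<nu> (C \<union> D) = \<nu> C + \<nu> D" using CD AB by (intro vector_measure_Un[OF \<nu>]) auto
        then show ?thesis using 1 P_upper[of "C \<union> D" "A \<union> B"] CD by (auto simp: ennreal_plus)
      next
        case 2
        then show ?thesis using P_upper[of D "A \<union> B"] CD by (auto simp: ennreal_neg)
      next
        case 3
        then show ?thesis using P_upper[of C "A \<union> B"] CD by (auto simp: ennreal_neg)
      qed
    qed
    have "P A + P B = (SUP C \<in> {C \<in> sets M. C \<subseteq> A}. ennreal (\<nu> C) + P B)"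
      unfolding P_def by (rule ennreal_SUP_add_left[symmetric, OF ne])
    also have "\<dots> = (SUP C \<in> {C \<in> sets M. C \<subseteq> A}. SUP D \<in> {D \<in> sets M. D \<subseteq> B}. ennreal (\<nu> C) + ennreal (\<nu> D))"
      unfolding P_def by (simp add: ennreal_SUP_add_right[OF ne])
    also have "\<dots> \<le> P (A \<union> B)" using 1 by (intro SUP_least) auto
    finally show ?thesis .
  qed
  show ?thesis
    unfolding countably_additive_def
  proof (intro allI impI)
    fix A :: "nat \<Rightarrow> 'a set"
    assume A: "range A \<subseteq> sets M" "disjoint_family A" "\<Union> (range A) \<in> sets M"
    have fin: "(\<Sum>i<n. P (A i)) \<le> P (\<Union>i<n. A i)" for n
    proof (induction n)
      case (Suc n)
      have "A i \<inter> A n = {}" if "i < n" for i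
        using that by (intro disjoint_family_onD[OF A(2)]) auto
      then have "(\<Union>i<n. A i) \<inter> A n = {}" by blast
      then have "P (\<Union>i<n. A i) + P (A n) \<le> P (\<Union>i<Suc n. A i)"
        using superadd[of "\<Union>i<n. A i" "A n"] by (simp add: lessThan_Suc Un_commute)
      then show ?case using Suc by (auto intro: order_trans add_right_mono)
    qed simp
    have "(\<Sum>i. P (A i)) \<le> P (\<Union>i. A i)"
      by (intro suminf_le_const order_trans[OF fin P_mono]) auto
    moreover have "P (\<Union>i. A i) \<le> (\<Sum>i. P (A i))"
    proof (rule P_least)
      fix B assume B: "B \<in> sets M" "B \<subseteq> (\<Union>i. A i)"
      have "(\<lambda>i. \<nu> (B \<inter> A i)) sums \<nu> (\<Union>i. B \<inter> A i)"
        using A B by (intro vector_measure_sums[OF \<nu>]) (auto simp: disjoint_family_on_def)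
      moreover have "(\<Union>i. B \<inter> A i) = B" using B(2) by auto
      ultimately have "(\<lambda>n. \<Sum>i<n. \<nu> (B \<inter> A i)) \<longlonglongrightarrow> \<nu> B" by (simp add: sums_def)
      then have "(\<lambda>n. ennreal (\<Sum>i<n. \<nu> (B \<inter> A i))) \<longlonglongrightarrow> ennreal (\<nu> B)" by (rule tendsto_ennrealI)
      then show "ennreal (\<nu> B) \<le> (\<Sum>i. P (A i))"
      proof (rule LIMSEQ_le_const2, intro exI[of _ 0] allI impI)
        fix n
        have "ennreal (\<Sum>i<n. \<nu> (B \<inter> A i)) \<le> (\<Sum>i<n. ennreal (\<nu> (B \<inter> A i)))" by (rule ennreal_sum_le)
        also have "\<dots> \<le> (\<Sum>i<n. P (A i))" using A(1) B(1) by (intro sum_mono P_upper) auto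
        also have "\<dots> \<le> (\<Sum>i. P (A i))" by (intro sum_le_suminf) auto
        finally show "ennreal (\<Sum>i<n. \<nu> (B \<inter> A i)) \<le> (\<Sum>i. P (A i))" .
      qed
    qed
    ultimately show "(\<Sum>i. P (A i)) = P (\<Union>i. A i)" by (rule antisym)
  qed
qed

lemma emeasure_positive_part:
  fixes \<nu> :: "'a set \<Rightarrow> real"
  assumes \<nu>: "vector_measure M \<nu>" and A: "A \<in> sets M"
  shows "emeasure (positive_part M \<nu>) A = (SUP B \<in> {B \<in> sets M. B \<subseteq> A}. ennreal (\<nu> B))"
  unfolding positive_part_def
proof (rule emeasure_measure_of_sigma[OF _ _ positive_part_countably_additive[OF \<nu>] A])
  have "{B \<in> sets M. B \<subseteq> {}} = {{}}" by auto
  then show "positive (sets M) (\<lambda>A. SUP B \<in> {B \<in> sets M. B \<subseteq> A}. ennreal (\<nu> B))"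
    by (simp add: positive_def vector_measure_empty[OF \<nu>])
qed (rule sets.sigma_algebra_axioms)

lemma sets_positive_part [simp]: "sets (positive_part M \<nu>) = sets M"
  by (simp add: positive_part_def)

lemma space_positive_part [simp]: "space (positive_part M \<nu>) = space M"
  by (simp add: positive_part_def)

lemma positive_part_density:
  fixes \<nu> :: "'a set \<Rightarrow> real"
  assumes \<mu>: "finite_measure \<mu>" "sets \<mu> = sets M" and \<nu>: "vector_measure M \<nu>"
    and ac: "\<And>A. A \<in> sets M \<Longrightarrow> emeasure \<mu> A = 0 \<Longrightarrow> \<nu> A = 0"
  shows "\<exists>h. integrable \<mu> h \<and> (\<forall>A\<in>sets M. measure (positive_part M \<nu>) A = (LINT \<omega>:A|\<mu>. h \<omega>))"
proof -
  interpret \<mu>: finite_measure \<mu> by fact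
  let ?N = "positive_part M \<nu>"
  obtain c where c: "\<And>A. A \<in> sets M \<Longrightarrow> \<bar>\<nu> A\<bar> \<le> c" using signed_measure_bounded[OF \<nu>] by blast
  have "\<nu> A \<le> c" if "A \<in> sets M" for A using c[OF that] by simp
  then have "emeasure ?N (space ?N) \<le> ennreal c"
    by (auto simp: emeasure_positive_part[OF \<nu>] intro!: SUP_least ennreal_leI)
  then have fin: "finite_measure ?N"
    by (intro finite_measureI) (auto simp: top_unique)
  then interpret N: finite_measure ?N .
  have "absolutely_continuous \<mu> ?N"
    unfolding absolutely_continuous_def
  proof
    fix A assume "A \<in> null_sets \<mu>"
    then have A: "A \<in> sets M" "emeasure \<mu> A = 0" using \<mu>(2) by auto
    have "\<nu> B = 0" if "B \<in> sets M" "B \<subseteq> A" for B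
      using ac[OF that(1)] emeasure_mono[of B A \<mu>] that A \<mu>(2) by auto
    then have "emeasure ?N A \<le> 0"
      unfolding emeasure_positive_part[OF \<nu> A(1)] by (intro SUP_least) auto
    then show "A \<in> null_sets ?N" using A by auto
  qed
  obtain D where D: "D \<in> borel_measurable \<mu>" "AE x in \<mu>. RN_deriv \<mu> ?N x = ennreal (D x)" "\<And>x. 0 \<le> D x"
    by (rule \<mu>.real_RN_deriv[OF fin \<open>absolutely_continuous \<mu> ?N\<close>]) (simp_all add: \<mu>(2))
  have N_eq: "emeasure ?N A = (\<integral>\<^sup>+x. ennreal (indicator A x * D x) \<partial>\<mu>)" if "A \<in> sets M" for A
  proof -
    have "?N = density \<mu> (RN_deriv \<mu> ?N)"
      using \<mu>.density_RN_deriv[OF \<open>absolutely_continuous \<mu> ?N\<close>] \<mu>(2) by simp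
    also have "\<dots> = density \<mu> (\<lambda>x. ennreal (D x))"
      using D by (intro density_cong) auto
    finally have "emeasure ?N A = emeasure (density \<mu> (\<lambda>x. ennreal (D x))) A" by simp
    also have "\<dots> = (\<integral>\<^sup>+x. ennreal (D x) * indicator A x \<partial>\<mu>)"
      using D(1) that \<mu>(2) by (intro emeasure_density) auto
    also have "\<dots> = (\<integral>\<^sup>+x. ennreal (indicator A x * D x) \<partial>\<mu>)"
      by (intro nn_integral_cong) (auto simp: indicator_def)
    finally show ?thesis .
  qed
  have "integrable \<mu> D"
  proof (rule integrableI_nonneg)
    have "(\<integral>\<^sup>+x. ennreal (D x) \<partial>\<mu>) = (\<integral>\<^sup>+x. ennreal (indicator (space M) x * D x) \<partial>\<mu>)"
      using sets_eq_imp_space_eq[OF \<mu>(2)] by (intro nn_integral_cong) auto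
    also have "\<dots> = emeasure ?N (space M)" using N_eq[of "space M"] by simp
    also have "\<dots> < \<infinity>" using N.emeasure_finite[of "space M"] by (simp add: less_top[symmetric])
    finally show "(\<integral>\<^sup>+x. ennreal (D x) \<partial>\<mu>) < \<infinity>" .
  qed (use D in auto)
  moreover have "measure ?N A = (LINT \<omega>:A|\<mu>. D \<omega>)" if A: "A \<in> sets M" for A
  proof -
    have "integrable \<mu> (\<lambda>x. indicator A x * D x)"
      using \<open>integrable \<mu> D\<close> A \<mu>(2) integrable_mult_indicator[of A \<mu> D] by simp
    then have "emeasure ?N A = ennreal (\<integral>x. indicator A x * D x \<partial>\<mu>)"
      unfolding N_eq[OF A] using D by (intro nn_integral_eq_integral) auto
    moreover have "0 \<le> (\<integral>x. indicator A x * D x \<partial>\<mu>)" using D by (intro integral_nonneg_AE) auto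
    ultimately show ?thesis by (simp add: measure_def set_lebesgue_integral_def)
  qed
  ultimately show ?thesis by blast
qed

lemma measure_of_eq_measure:
  assumes "sets N = sets M" "\<And>A. A \<in> sets M \<Longrightarrow> f A = emeasure N A"
  shows "measure_of (space M) (sets M) f = N"
proof -
  have "measure_of (space M) (sets M) f = measure_of (space M) (sets M) (emeasure N)"
    using assms(2) by (intro measure_of_eq sets.space_closed) (simp add: sets.sigma_sets_eq)
  also have "\<dots> = measure_of (space N) (sets N) (emeasure N)"
    by (simp only: assms(1) sets_eq_imp_space_eq[OF assms(1)])
  finally show ?thesis by (simp add: measure_of_of_measure)
qed

text \<open>
  Once \<open>\<nu>\<close> has a density \<open>h\<close> with respect to \<open>\<mu>\<close>, its positive part and its variation have the densities \<open>max 0 h\<close> and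
  \<open>\<bar>h\<bar>\<close>: the suprema that define them are attained at the part of a set where \<open>h\<close> is nonnegative, and at the
  partition of the set by the sign of \<open>h\<close>.
\<close>

context
  fixes M \<mu> :: "'a measure" and \<nu> :: "'a set \<Rightarrow> real" and h :: "'a \<Rightarrow> real"
  assumes sets_\<mu>: "sets \<mu> = sets M" and h: "integrable \<mu> h"
    and \<nu>_h: "\<And>A. A \<in> sets M \<Longrightarrow> \<nu> A = (LINT \<omega>:A|\<mu>. h \<omega>)"
begin

lemma space_\<mu>: "space \<mu> = space M"
  by (rule sets_eq_imp_space_eq[OF sets_\<mu>])

lemma emeasure_density_set_integral:
  assumes g: "integrable \<mu> g" "\<And>x. 0 \<le> g x" and A: "A \<in> sets M"
  shows "emeasure (density \<mu> (\<lambda>x. ennreal (g x))) A = ennreal (LINT x:A|\<mu>. g x)"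
proof -
  have "emeasure (density \<mu> (\<lambda>x. ennreal (g x))) A = (\<integral>\<^sup>+x. ennreal (g x) * indicator A x \<partial>\<mu>)"
    using g(1) A sets_\<mu> by (intro emeasure_density) auto
  also have "\<dots> = (\<integral>\<^sup>+x. ennreal (indicator A x *\<^sub>R g x) \<partial>\<mu>)"
    by (intro nn_integral_cong) (auto simp: indicator_def)
  also have "\<dots> = ennreal (LINT x:A|\<mu>. g x)"
    unfolding set_lebesgue_integral_def using g A sets_\<mu>
    by (intro nn_integral_eq_integral integrable_mult_indicator) auto
  finally show ?thesis .
qed

lemma set_integral_mono_sets:
  fixes g k :: "'a \<Rightarrow> real"
  assumes g: "integrable \<mu> g" "integrable \<mu> k" and AB: "A \<in> sets M" "B \<in> sets M" "A \<subseteq> B"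
    and le: "\<And>x. g x \<le> k x" "\<And>x. 0 \<le> k x"
  shows "(LINT x:A|\<mu>. g x) \<le> (LINT x:B|\<mu>. k x)"
  unfolding set_lebesgue_integral_def
proof (rule Bochner_Integration.integral_mono)
  have AB': "A \<in> sets \<mu>" "B \<in> sets \<mu>" using AB by (simp_all add: sets_\<mu>)
  show "integrable \<mu> (\<lambda>x. indicat_real A x *\<^sub>R g x)" "integrable \<mu> (\<lambda>x. indicat_real B x *\<^sub>R k x)"
    by (rule integrable_mult_indicator[OF AB'(1) g(1)], rule integrable_mult_indicator[OF AB'(2) g(2)])
  show "indicat_real A x *\<^sub>R g x \<le> indicat_real B x *\<^sub>R k x" for x
    using AB(3) le[of x] by (auto simp: indicator_def)
qed

lemma h_measurable [measurable]: "h \<in> borel_measurable \<mu>"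
  by (rule borel_measurable_integrable[OF h])

lemma positive_part_eq_density:
  "positive_part M \<nu> = density \<mu> (\<lambda>x. ennreal (max 0 (h x)))"
  unfolding positive_part_def
proof (rule measure_of_eq_measure)
  have hp: "integrable \<mu> (\<lambda>x. max 0 (h x))" using h by simp
  fix A assume A: "A \<in> sets M"
  show "(SUP B \<in> {B \<in> sets M. B \<subseteq> A}. ennreal (\<nu> B)) = emeasure (density \<mu> (\<lambda>x. ennreal (max 0 (h x)))) A"
    unfolding emeasure_density_set_integral[OF hp max.cobounded1 A]
  proof (rule antisym)
    show "(SUP B \<in> {B \<in> sets M. B \<subseteq> A}. ennreal (\<nu> B)) \<le> ennreal (LINT x:A|\<mu>. max 0 (h x))"
    proof (rule SUP_least)
      fix B assume "B \<in> {B \<in> sets M. B \<subseteq> A}"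
      then have B: "B \<in> sets M" "B \<subseteq> A" by auto
      show "ennreal (\<nu> B) \<le> ennreal (LINT x:A|\<mu>. max 0 (h x))"
        unfolding \<nu>_h[OF B(1)] by (intro ennreal_leI set_integral_mono_sets h hp A B) auto
    qed
    define B where "B = A \<inter> {x \<in> space \<mu>. 0 \<le> h x}"
    have "{x \<in> space \<mu>. 0 \<le> h x} \<in> sets M" unfolding sets_\<mu>[symmetric] by measurable
    then have B: "B \<in> sets M" unfolding B_def using A by (intro sets.Int)
    have "(LINT x:A|\<mu>. max 0 (h x)) = (LINT x:B|\<mu>. h x)"
      unfolding set_lebesgue_integral_def
      by (intro Bochner_Integration.integral_cong) (auto simp: B_def indicator_def)
    then have "ennreal (LINT x:A|\<mu>. max 0 (h x)) = ennreal (\<nu> B)" by (simp add: \<nu>_h[OF B])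
    also have "\<dots> \<le> (SUP B \<in> {B \<in> sets M. B \<subseteq> A}. ennreal (\<nu> B))"
      using B by (intro SUP_upper) (auto simp: B_def)
    finally show "ennreal (LINT x:A|\<mu>. max 0 (h x)) \<le> (SUP B \<in> {B \<in> sets M. B \<subseteq> A}. ennreal (\<nu> B))" .
  qed
qed (simp add: sets_\<mu>)

lemma variation_measure_eq_density:
  "variation_measure M \<nu> = density \<mu> (\<lambda>x. ennreal \<bar>h x\<bar>)"
  unfolding variation_measure_def
proof (rule measure_of_eq_measure)
  have ha: "integrable \<mu> (\<lambda>x. \<bar>h x\<bar>)" by (rule integrable_abs[OF h])
  let ?N = "density \<mu> (\<lambda>x. ennreal \<bar>h x\<bar>)"
  fix A assume A: "A \<in> sets M"
  show "variation M \<nu> A = emeasure ?N A"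
  proof (rule antisym)
    show "variation M \<nu> A \<le> emeasure ?N A"
      unfolding variation_def
    proof (rule SUP_least)
      fix P assume "P \<in> {P. finite P \<and> P \<subseteq> sets M \<and> partition_on A P}"
      then have P: "finite P" "P \<subseteq> sets M" "partition_on A P" by auto
      have "ennreal \<bar>\<nu> B\<bar> \<le> emeasure ?N B" if "B \<in> P" for B
      proof -
        have B: "B \<in> sets M" using P(2) that by auto
        have "\<nu> B \<le> (LINT x:B|\<mu>. \<bar>h x\<bar>)"
          unfolding \<nu>_h[OF B] by (intro set_integral_mono_sets h ha B order_refl) auto
        moreover have "(LINT x:B|\<mu>. - h x) \<le> (LINT x:B|\<mu>. \<bar>h x\<bar>)"
          using h by (intro set_integral_mono_sets ha B order_refl) auto
        then have "- \<nu> B \<le> (LINT x:B|\<mu>. \<bar>h x\<bar>)"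
          unfolding \<nu>_h[OF B] by (simp add: set_lebesgue_integral_def)
        ultimately have "\<bar>\<nu> B\<bar> \<le> (LINT x:B|\<mu>. \<bar>h x\<bar>)" by simp
        then show ?thesis
          unfolding emeasure_density_set_integral[OF ha abs_ge_zero B] by (rule ennreal_leI)
      qed
      then have "(\<Sum>B\<in>P. ennreal \<bar>\<nu> B\<bar>) \<le> (\<Sum>B\<in>P. emeasure ?N B)" by (rule sum_mono)
      also have "\<dots> = emeasure ?N (\<Union>B\<in>P. B)"
        using P sets_\<mu> by (intro sum_emeasure) (auto simp: partition_on_def disjoint_def disjoint_family_on_def)
      also have "(\<Union>B\<in>P. B) = A" using P(3) by (simp add: partition_on_def)
      finally show "(\<Sum>B\<in>P. ennreal \<bar>\<nu> B\<bar>) \<le> emeasure ?N A" .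
    qed
    define Ap where "Ap = A \<inter> {x \<in> space \<mu>. 0 \<le> h x}"
    define An where "An = A \<inter> {x \<in> space \<mu>. h x < 0}"
    have "{x \<in> space \<mu>. 0 \<le> h x} \<in> sets M" "{x \<in> space \<mu>. h x < 0} \<in> sets M"
      unfolding sets_\<mu>[symmetric] by measurable
    then have B: "Ap \<in> sets M" "An \<in> sets M" unfolding Ap_def An_def using A by (auto intro: sets.Int)
    have AU: "Ap \<union> An = A" "Ap \<inter> An = {}"
      using sets.sets_into_space[OF A] by (auto simp: Ap_def An_def space_\<mu>)
    \<comment> \<open>The members of a partition are nonempty.\<close>
    define P where "P = {Ap, An} - {{}}"
    have "(LINT x:Ap|\<mu>. \<bar>h x\<bar>) = \<nu> Ap"
      unfolding \<nu>_h[OF B(1)] set_lebesgue_integral_def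
      by (intro Bochner_Integration.integral_cong) (auto simp: Ap_def indicator_def)
    moreover have "(LINT x:An|\<mu>. \<bar>h x\<bar>) = (LINT x:An|\<mu>. - h x)"
      unfolding set_lebesgue_integral_def
      by (intro Bochner_Integration.integral_cong) (auto simp: An_def indicator_def)
    then have "(LINT x:An|\<mu>. \<bar>h x\<bar>) = - \<nu> An"
      unfolding \<nu>_h[OF B(2)] by (simp add: set_lebesgue_integral_def)
    moreover have "0 \<le> (LINT x:B|\<mu>. \<bar>h x\<bar>)" for B
      unfolding set_lebesgue_integral_def by (intro Bochner_Integration.integral_nonneg) simp
    from this[of Ap] this[of An]
    have "emeasure ?N Ap = ennreal \<bar>\<nu> Ap\<bar>" "emeasure ?N An = ennreal \<bar>\<nu> An\<bar>"
      using calculation by (simp_all add: emeasure_density_set_integral[OF ha abs_ge_zero] B)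
    moreover have "emeasure ?N A = emeasure ?N Ap + emeasure ?N An"
      using plus_emeasure[of Ap ?N An] B AU sets_\<mu> by simp
    moreover have "\<nu> {} = 0" using \<nu>_h[of "{}"] by (simp add: set_lebesgue_integral_def)
    then have "ennreal \<bar>\<nu> Ap\<bar> + ennreal \<bar>\<nu> An\<bar> = (\<Sum>B\<in>P. ennreal \<bar>\<nu> B\<bar>)"
      using AU(2) by (cases "Ap = {}"; cases "An = {}"; cases "Ap = An") (auto simp: P_def insert_Diff_if)
    ultimately have "emeasure ?N A = (\<Sum>B\<in>P. ennreal \<bar>\<nu> B\<bar>)" by simp
    also have "\<dots> \<le> variation M \<nu> A"
      unfolding variation_def
    proof (rule SUP_upper)
      have "partition_on A P"
        using AU unfolding P_def partition_on_def disjoint_def by blast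
      then show "P \<in> {P. finite P \<and> P \<subseteq> sets M \<and> partition_on A P}" using B by (auto simp: P_def)
    qed
    finally show "emeasure ?N A \<le> variation M \<nu> A" .
  qed
qed (simp add: sets_\<mu>)

end

text \<open>
  By the Jordan decomposition \<open>\<nu> A\<close> is the difference of the positive parts of \<open>\<nu>\<close> and of \<open>- \<nu>\<close> on \<open>A\<close>, and the
  Radon-Nikodym theorem for positive measures applies to both. One inequality of the decomposition, used for
  \<open>\<nu>\<close> and for \<open>- \<nu>\<close>, suffices; it follows from \<open>\<rho> B = \<rho> A - \<rho> (A - B)\<close>.
\<close>

lemma signed_RN_deriv_exists:
  fixes \<nu> :: "'a set \<Rightarrow> real"
  assumes \<mu>: "finite_measure \<mu>" "sets \<mu> = sets M" and \<nu>: "vector_measure M \<nu>"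
    and ac: "\<And>A. A \<in> sets M \<Longrightarrow> emeasure \<mu> A = 0 \<Longrightarrow> \<nu> A = 0"
  shows "\<exists>h. integrable \<mu> h \<and> (\<forall>A\<in>sets \<mu>. \<nu> A = (LINT \<omega>:A|\<mu>. h \<omega>))"
proof -
  let ?P = "positive_part M \<nu>" and ?N = "positive_part M (\<lambda>A. - \<nu> A)"
  have \<nu>': "vector_measure M (\<lambda>A. - \<nu> A)" by (rule vector_measure_uminus[OF \<nu>])
  obtain hp where hp: "integrable \<mu> hp" "\<And>A. A \<in> sets M \<Longrightarrow> measure ?P A = (LINT \<omega>:A|\<mu>. hp \<omega>)"
    using positive_part_density[OF \<mu> \<nu> ac] by blast
  obtain hn where hn: "integrable \<mu> hn" "\<And>A. A \<in> sets M \<Longrightarrow> measure ?N A = (LINT \<omega>:A|\<mu>. hn \<omega>)"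
    using positive_part_density[OF \<mu> \<nu>'] ac by auto
  have le: "\<rho> A + measure (positive_part M (\<lambda>A. - \<rho> A)) A \<ge> measure (positive_part M \<rho>) A"
    if \<rho>: "vector_measure M \<rho>" and A: "A \<in> sets M" for \<rho> :: "'a set \<Rightarrow> real" and A
  proof -
    let ?n = "positive_part M (\<lambda>A. - \<rho> A)"
    obtain c where c: "\<And>A. A \<in> sets M \<Longrightarrow> \<bar>\<rho> A\<bar> \<le> c" using signed_measure_bounded[OF \<rho>] by blast
    have \<rho>': "vector_measure M (\<lambda>A. - \<rho> A)" by (rule vector_measure_uminus[OF \<rho>])
    have "emeasure ?n A \<le> ennreal c"
      unfolding emeasure_positive_part[OF \<rho>' A] using c by (intro SUP_least ennreal_leI) (auto simp: abs_le_iff)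
    then have fin: "emeasure ?n A = ennreal (measure ?n A)"
      by (intro emeasure_eq_ennreal_measure) (auto simp: top_unique)
    have low: "- \<rho> C \<le> measure ?n A" if "C \<in> sets M" "C \<subseteq> A" for C
    proof -
      have "ennreal (- \<rho> C) \<le> emeasure ?n A"
        unfolding emeasure_positive_part[OF \<rho>' A] using that by (intro SUP_upper) auto
      then show ?thesis
        unfolding fin using measure_nonneg[of ?n A] by (auto simp: ennreal_le_iff2)
    qed
    have nn: "0 \<le> \<rho> A + measure ?n A" using low[OF A] by simp
    have "emeasure (positive_part M \<rho>) A \<le> ennreal (\<rho> A + measure ?n A)"
      unfolding emeasure_positive_part[OF \<rho> A]
    proof (intro SUP_least ennreal_leI)
      fix B assume "B \<in> {B \<in> sets M. B \<subseteq> A}"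
      then have B: "B \<in> sets M" "B \<subseteq> A" by auto
      have "\<rho> A = \<rho> B + \<rho> (A - B)" using vector_measure_split[OF \<rho> A B(1)] B(2) by (simp add: Int_absorb1)
      then show "\<rho> B \<le> \<rho> A + measure ?n A" using low[of "A - B"] A B by auto
    qed
    then show ?thesis unfolding measure_def[of "positive_part M \<rho>"] using nn by (simp add: enn2real_leI)
  qed
  have "\<nu> A = (LINT \<omega>:A|\<mu>. hp \<omega> - hn \<omega>)" if A: "A \<in> sets \<mu>" for A
  proof -
    have AM: "A \<in> sets M" using A \<mu>(2) by simp
    have "\<nu> A = measure ?P A - measure ?N A"
      using le[OF \<nu> AM] le[OF \<nu>' AM] by simp
    also have "\<dots> = (LINT \<omega>:A|\<mu>. hp \<omega>) - (LINT \<omega>:A|\<mu>. hn \<omega>)" using hp(2)[OF AM] hn(2)[OF AM] by simp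
    also have "\<dots> = (LINT \<omega>:A|\<mu>. hp \<omega> - hn \<omega>)"
      by (rule set_integral_diff(2)[symmetric])
        (use integrable_mult_indicator[OF A hp(1)] integrable_mult_indicator[OF A hn(1)]
          in \<open>simp_all only: set_integrable_def\<close>)
    finally show ?thesis .
  qed
  then show ?thesis using hp(1) hn(1) by (intro exI[of _ "\<lambda>\<omega>. hp \<omega> - hn \<omega>"]) auto
qed

lemma equivalent_measure_null:
  assumes eq: "equivalent_measure M m \<mu>" and m: "vector_measure M m"
    and A: "A \<in> sets M" "emeasure \<mu> A = 0"
  shows "scalar_measure m x' A = 0"
proof (cases "A = {}")
  case True
  then show ?thesis using vector_measure_empty[OF m] by (simp add: scalar_measure_def blinfun.zero_right)
next
  case False
  \<comment> \<open>The semivariation only involves functionals of norm at most one.\<close>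
  define y' where "y' = (1 / (norm x' + 1)) *\<^sub>R x'"
  have pos: "0 < norm x' + 1" by (simp add: add_nonneg_pos)
  have "norm y' \<le> 1" using pos by (simp add: y'_def)
  have "partition_on A {A}" using False by (simp add: partition_on_def)
  then have "(\<Sum>B\<in>{A}. ennreal \<bar>scalar_measure m y' B\<bar>) \<le> variation M (scalar_measure m y') A"
    unfolding variation_def using A(1) by (intro SUP_upper) simp
  also have "\<dots> \<le> semivariation M m A"
    unfolding semivariation_def using \<open>norm y' \<le> 1\<close> by (intro SUP_upper) simp
  also have "\<dots> = 0" using eq A by (simp add: equivalent_measure_def)
  finally have "scalar_measure m y' A = 0" by simp
  then show ?thesis using pos by (simp add: scalar_measure_def y'_def blinfun.scaleR_left)
qed

text \<open>
  All three measures attached to \<open>\<nu>\<close> have densities with respect to \<open>\<mu>\<close>, so both statements become statements about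
  \<open>\<mu>\<close>-integrals of \<open>f \<omega> * h \<omega>\<close>.
\<close>

lemma signed_integral_eq_RN:
  fixes \<nu> :: "'a set \<Rightarrow> real"
  assumes \<mu>: "finite_measure \<mu>" "sets \<mu> = sets M" and \<nu>: "vector_measure M \<nu>"
    and ac: "\<And>A. A \<in> sets M \<Longrightarrow> emeasure \<mu> A = 0 \<Longrightarrow> \<nu> A = 0"
    and f: "f \<in> borel_measurable M" "signed_integrable M \<nu> f"
  shows "signed_integral M \<nu> (space M) f = (LINT \<omega>|\<mu>. f \<omega> * signed_RN_deriv \<mu> \<nu> \<omega>)"
    and "ennreal \<bar>signed_integral M \<nu> (space M) f\<bar> \<le> (\<integral>\<^sup>+\<omega>. ennreal \<bar>f \<omega>\<bar> \<partial>variation_measure M \<nu>)"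
proof -
  define h where "h = signed_RN_deriv \<mu> \<nu>"
  have "integrable \<mu> h \<and> (\<forall>A\<in>sets \<mu>. \<nu> A = (LINT \<omega>:A|\<mu>. h \<omega>))"
    unfolding h_def signed_RN_deriv_def by (rule someI_ex[OF signed_RN_deriv_exists[OF \<mu> \<nu> ac]])
  then have h: "integrable \<mu> h" "\<And>A. A \<in> sets M \<Longrightarrow> \<nu> A = (LINT \<omega>:A|\<mu>. h \<omega>)"
    using \<mu>(2) by auto
  have h': "integrable \<mu> (\<lambda>\<omega>. - h \<omega>)" "\<And>A. A \<in> sets M \<Longrightarrow> - \<nu> A = (LINT \<omega>:A|\<mu>. - h \<omega>)"
    using h by (auto simp: set_lebesgue_integral_def)
  have [measurable]: "h \<in> borel_measurable \<mu>" using h(1) by (rule borel_measurable_integrable)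
  have [measurable]: "f \<in> borel_measurable \<mu>" using f(1) \<mu>(2) measurable_cong_sets by blast
  have sp: "space \<mu> = space M" by (rule sets_eq_imp_space_eq[OF \<mu>(2)])
  have V: "variation_measure M \<nu> = density \<mu> (\<lambda>\<omega>. ennreal \<bar>h \<omega>\<bar>)"
    by (rule variation_measure_eq_density[OF \<mu>(2) h])
  have P: "positive_part M \<nu> = density \<mu> (\<lambda>\<omega>. ennreal (max 0 (h \<omega>)))"
    by (rule positive_part_eq_density[OF \<mu>(2) h])
  have N: "positive_part M (\<lambda>A. - \<nu> A) = density \<mu> (\<lambda>\<omega>. ennreal (max 0 (- h \<omega>)))"
    by (rule positive_part_eq_density[OF \<mu>(2) h'])
  have "integrable (density \<mu> (\<lambda>\<omega>. ennreal \<bar>h \<omega>\<bar>)) f"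
    using f(2) by (simp add: signed_integrable_def V)
  then have "integrable \<mu> (\<lambda>\<omega>. \<bar>h \<omega>\<bar> *\<^sub>R f \<omega>)" by (subst integrable_density[symmetric]) auto
  then have int: "integrable \<mu> (\<lambda>\<omega>. \<bar>h \<omega>\<bar> * f \<omega>)" by simp
  have intp: "integrable \<mu> (\<lambda>\<omega>. max 0 (h \<omega>) * f \<omega>)"
    by (rule Bochner_Integration.integrable_bound[OF int]) (auto simp: abs_mult intro!: mult_right_mono)
  have intn: "integrable \<mu> (\<lambda>\<omega>. max 0 (- h \<omega>) * f \<omega>)"
    by (rule Bochner_Integration.integrable_bound[OF int]) (auto simp: abs_mult intro!: mult_right_mono)
  have part: "(LINT \<omega>:space M|density \<mu> (\<lambda>x. ennreal (max 0 (k x))). f \<omega>) = (\<integral>\<omega>. max 0 (k \<omega>) * f \<omega> \<partial>\<mu>)"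
    if [measurable]: "k \<in> borel_measurable \<mu>" for k
  proof -
    have "(LINT \<omega>:space M|density \<mu> (\<lambda>x. ennreal (max 0 (k x))). f \<omega>)
        = (\<integral>\<omega>. f \<omega> \<partial>density \<mu> (\<lambda>x. ennreal (max 0 (k x))))"
      unfolding set_lebesgue_integral_def by (intro Bochner_Integration.integral_cong) (auto simp: sp)
    also have "\<dots> = (\<integral>\<omega>. max 0 (k \<omega>) * f \<omega> \<partial>\<mu>)" by (subst integral_density) auto
    finally show ?thesis .
  qed
  have "signed_integral M \<nu> (space M) f = (\<integral>\<omega>. max 0 (h \<omega>) * f \<omega> \<partial>\<mu>) - (\<integral>\<omega>. max 0 (- h \<omega>) * f \<omega> \<partial>\<mu>)"
    unfolding signed_integral_def P N by (simp add: part)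
  also have "\<dots> = (\<integral>\<omega>. max 0 (h \<omega>) * f \<omega> - max 0 (- h \<omega>) * f \<omega> \<partial>\<mu>)"
    by (rule Bochner_Integration.integral_diff[OF intp intn, symmetric])
  also have "\<dots> = (\<integral>\<omega>. f \<omega> * h \<omega> \<partial>\<mu>)"
    by (intro Bochner_Integration.integral_cong) (auto simp: max_def)
  finally have eq: "signed_integral M \<nu> (space M) f = (\<integral>\<omega>. f \<omega> * h \<omega> \<partial>\<mu>)" .
  then show "signed_integral M \<nu> (space M) f = (LINT \<omega>|\<mu>. f \<omega> * signed_RN_deriv \<mu> \<nu> \<omega>)" by (simp add: h_def)
  have "ennreal \<bar>\<integral>\<omega>. f \<omega> * h \<omega> \<partial>\<mu>\<bar> \<le> (\<integral>\<^sup>+\<omega>. ennreal \<bar>f \<omega> * h \<omega>\<bar> \<partial>\<mu>)"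
    using integral_norm_bound_ennreal[of \<mu> "\<lambda>\<omega>. f \<omega> * h \<omega>"] integrable_norm_iff[of "\<lambda>\<omega>. f \<omega> * h \<omega>" \<mu>]
      integrable_norm[OF int] by (simp add: abs_mult mult.commute)
  also have "\<dots> = (\<integral>\<^sup>+\<omega>. ennreal \<bar>h \<omega>\<bar> * ennreal \<bar>f \<omega>\<bar> \<partial>\<mu>)"
    by (intro nn_integral_cong) (simp add: abs_mult ennreal_mult' mult.commute)
  also have "\<dots> = (\<integral>\<^sup>+\<omega>. ennreal \<bar>f \<omega>\<bar> \<partial>variation_measure M \<nu>)"
    unfolding V by (subst nn_integral_density) auto
  finally show "ennreal \<bar>signed_integral M \<nu> (space M) f\<bar> \<le> (\<integral>\<^sup>+\<omega>. ennreal \<bar>f \<omega>\<bar> \<partial>variation_measure M \<nu>)"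
    unfolding eq .
qed

section \<open>The integration map\<close>

text \<open>
  The definite description denotes the integral because continuous functionals separate points.
\<close>

lemma integration_map_functional:
  fixes m :: "'a set \<Rightarrow> 'x::real_normed_vector"
  assumes f: "f \<in> L1 M m"
  shows "blinfun_apply x' (integration_map M m f) = signed_integral M (scalar_measure m x') (space M) f"
proof -
  obtain y where y: "\<And>x' :: 'x \<Rightarrow>\<^sub>L real. blinfun_apply x' y = signed_integral M (scalar_measure m x') (space M) f"
    using f sets.top[of M] unfolding L1_def vm_integrable_def by blast
  have "integration_map M m f = y"
    unfolding integration_map_def vm_integral_def
  proof (rule the_equality)
    fix z assume "\<forall>x' :: 'x \<Rightarrow>\<^sub>L real. blinfun_apply x' z = signed_integral M (scalar_measure m x') (space M) f"
    then have "blinfun_apply x' z = x' y" for x' :: "'x \<Rightarrow>\<^sub>L real" using y by simp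
    then show "z = y" by (rule functionals_separate_points)
  qed (use y in blast)
  then show ?thesis using y by simp
qed

context
  fixes M \<mu> :: "'a measure" and m :: "'a set \<Rightarrow> 'x::real_normed_vector"
  assumes m: "vector_measure M m" and \<mu>: "finite_measure \<mu>" "equivalent_measure M m \<mu>"
begin

lemma L1_signed_integral:
  assumes f: "f \<in> L1 M m"
  shows "blinfun_apply x' (integration_map M m f) = RN_functional \<mu> m x' f"
    and "ennreal \<bar>blinfun_apply x' (integration_map M m f)\<bar>
      \<le> (\<integral>\<^sup>+\<omega>. ennreal \<bar>f \<omega>\<bar> \<partial>variation_measure M (scalar_measure m x'))"
proof -
  have s: "sets \<mu> = sets M" using \<mu>(2) by (simp add: equivalent_measure_def)
  have fm: "f \<in> borel_measurable M" "signed_integrable M (scalar_measure m x') f"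
    using f by (auto simp: L1_def vm_integrable_def)
  note RN = signed_integral_eq_RN[OF \<mu>(1) s vector_measure_scalar[OF m] equivalent_measure_null[OF \<mu>(2) m] fm]
  show "blinfun_apply x' (integration_map M m f) = RN_functional \<mu> m x' f"
    unfolding integration_map_functional[OF f] RN_functional_def by (rule RN(1))
  show "ennreal \<bar>blinfun_apply x' (integration_map M m f)\<bar>
      \<le> (\<integral>\<^sup>+\<omega>. ennreal \<bar>f \<omega>\<bar> \<partial>variation_measure M (scalar_measure m x'))"
    unfolding integration_map_functional[OF f] by (rule RN(2))
qed

lemma integration_map_contraction:
  assumes f: "f \<in> L1_unit_ball M m"
  shows "norm (integration_map M m f) \<le> 1"
proof -
  have f': "f \<in> L1 M m" "L1_norm M m f \<le> 1" using f by (auto simp: L1_unit_ball_def)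
  obtain x' :: "'x \<Rightarrow>\<^sub>L real" where x': "norm x' \<le> 1"
      "x' (integration_map M m f) = norm (integration_map M m f)"
    by (rule norming_functional)
  have "ennreal (norm (integration_map M m f))
      \<le> (\<integral>\<^sup>+\<omega>. ennreal \<bar>f \<omega>\<bar> \<partial>variation_measure M (scalar_measure m x'))"
    using L1_signed_integral(2)[OF f'(1), of x'] by (simp add: x'(2))
  also have "\<dots> \<le> L1_norm M m f" unfolding L1_norm_def using x'(1) by (intro SUP_upper) simp
  also have "\<dots> \<le> 1" by (rule f'(2))
  finally show ?thesis by simp
qed

lemma finite_rank_comp_integration_map:
  fixes S :: "'x \<Rightarrow>\<^sub>L 'x"
  assumes "finite_rank S"
  shows "finite_rank_RN_operator M \<mu> m (\<lambda>f. S (integration_map M m f))"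
proof -
  obtain B where "finite B" "range (blinfun_apply S) \<subseteq> span B" using assms by (auto simp: finite_rank_def)
  then obtain n g y where S: "\<And>x. S x = (\<Sum>i<(n::nat). blinfun_apply (g i) x *\<^sub>R y i)"
    using finite_rank_expansion by metis
  show ?thesis
    unfolding finite_rank_RN_operator_def
    by (intro exI[of _ n] exI[of _ g] exI[of _ y] ballI) (simp add: S L1_signed_integral(1))
qed

end

text \<open>
  Norm balls are weakly closed, since the norm of \<open>w\<close> is the value of a functional of norm at most one.
\<close>

lemma weak_closure_norm_le:
  fixes K :: "'x::real_normed_vector set"
  assumes K: "\<And>x. x \<in> K \<Longrightarrow> norm x \<le> c" and w: "w \<in> weak_topology closure_of K"
  shows "norm w \<le> c"
proof -
  obtain f :: "'x \<Rightarrow>\<^sub>L real" where f: "norm f \<le> 1" "f w = norm w" by (rule norming_functional)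
  have "closedin weak_topology {v \<in> topspace weak_topology. f v \<in> {..c}}"
    by (rule closedin_continuous_map_preimage[OF continuous_map_weak_topology]) simp
  moreover have "f v \<le> c" if "v \<in> K" for v
    using norm_blinfun[of f v] mult_right_mono[OF f(1), of "norm v"] K[OF that] by simp
  then have "K \<subseteq> {v \<in> topspace weak_topology. f v \<in> {..c}}" by auto
  ultimately have "weak_topology closure_of K \<subseteq> {v \<in> topspace weak_topology. f v \<in> {..c}}"
    by (intro closure_of_minimal)
  then show ?thesis using w f(2) by auto
qed

theorem theorem3p7:
  fixes M \<mu> :: "'a measure" and m :: "'a set \<Rightarrow> 'x::banach"
  assumes "approximation_property TYPE('x)"
    and "vector_measure M m"
    and "finite_measure \<mu>"
    and "equivalent_measure M m \<mu>"
    and "weakly_compact_on_L1 M m (integration_map M m)"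
  shows "\<exists>(D :: (('a \<Rightarrow> real) set \<times> nat) set) le R.
           directed_set D le \<and>
           (\<forall>\<alpha>\<in>D. finite_rank_RN_operator M \<mu> m (R \<alpha>) \<and> L1_opnorm M m (R \<alpha>) \<le> 1) \<and>
           (\<forall>f\<in>L1 M m. ((\<lambda>\<alpha>. R \<alpha> f) \<longlongrightarrow> integration_map M m f) (net_filter D le))"
proof -
  let ?I = "integration_map M m"
  define W where "W = weak_topology closure_of (?I ` L1_unit_ball M m)"
  have W: "compactin weak_topology W"
    using assms(5) by (simp add: weakly_compact_on_L1_def W_def)
  have contraction: "norm (?I f) \<le> 1" if "f \<in> L1_unit_ball M m" for f
    using integration_map_contraction[OF assms(2-4) that] .
  have bound: "norm w \<le> 1" if "w \<in> W" for w
    using weak_closure_norm_le[of "?I ` L1_unit_ball M m" 1 w] contraction that by (auto simp: W_def)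
  have I_W: "?I f \<in> W" if "f \<in> L1_unit_ball M m" for f
    using closure_of_subset[of "?I ` L1_unit_ball M m" weak_topology] that by (auto simp: W_def)
  \<comment> \<open>The index \<open>(F, n)\<close> asks for an error of at most \<open>1 / Suc n\<close> at the functions in \<open>F\<close>.\<close>
  define D :: "(('a \<Rightarrow> real) set \<times> nat) set" where "D = {(F, n). finite F \<and> F \<subseteq> L1 M m}"
  define le :: "(('a \<Rightarrow> real) set \<times> nat) \<Rightarrow> (('a \<Rightarrow> real) set \<times> nat) \<Rightarrow> bool" where
    "le = (\<lambda>(F, n) (G, k). F \<subseteq> G \<and> n \<le> k)"
  have "\<exists>S :: 'x \<Rightarrow>\<^sub>L 'x. finite_rank S \<and> (\<forall>x\<in>?I ` fst \<alpha>. norm (S x - x) \<le> 1 / real (Suc (snd \<alpha>))) \<and>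
      (\<forall>w\<in>W. norm (S w) \<le> 1)" if "\<alpha> \<in> D" for \<alpha>
    using that by (intro finite_rank_contraction_on_weakly_compact[OF assms(1) W bound]) (auto simp: D_def)
  then obtain S :: "('a \<Rightarrow> real) set \<times> nat \<Rightarrow> 'x \<Rightarrow>\<^sub>L 'x" where S:
      "\<And>\<alpha>. \<alpha> \<in> D \<Longrightarrow> finite_rank (S \<alpha>)"
      "\<And>\<alpha> f. \<alpha> \<in> D \<Longrightarrow> f \<in> fst \<alpha> \<Longrightarrow> norm (S \<alpha> (?I f) - ?I f) \<le> 1 / real (Suc (snd \<alpha>))"
      "\<And>\<alpha> w. \<alpha> \<in> D \<Longrightarrow> w \<in> W \<Longrightarrow> norm (S \<alpha> w) \<le> 1"
    by (metis image_eqI)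
  define R where "R = (\<lambda>\<alpha> f. S \<alpha> (?I f))"
  have dir: "directed_set D le"
    unfolding directed_set_def
  proof (intro conjI ballI)
    show "D \<noteq> {}" by (auto simp: D_def)
    show "reflp_on D le" by (auto simp: reflp_on_def le_def)
    show "transp_on D le" by (fastforce simp: transp_on_def le_def)
    fix a b assume "a \<in> D" "b \<in> D"
    then show "\<exists>c\<in>D. le a c \<and> le b c"
      by (intro bexI[of _ "(fst a \<union> fst b, max (snd a) (snd b))"]) (auto simp: D_def le_def)
  qed
  have RN: "finite_rank_RN_operator M \<mu> m (R \<alpha>)" if "\<alpha> \<in> D" for \<alpha>
    unfolding R_def by (rule finite_rank_comp_integration_map[OF assms(2-4) S(1)[OF that]])
  have opnorm: "L1_opnorm M m (R \<alpha>) \<le> 1" if "\<alpha> \<in> D" for \<alpha>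
    unfolding L1_opnorm_def R_def using S(3)[OF that I_W] by (intro SUP_least) simp
  have lim: "((\<lambda>\<alpha>. R \<alpha> f) \<longlongrightarrow> ?I f) (net_filter D le)" if f: "f \<in> L1 M m" for f
  proof (rule tendstoI)
    fix e :: real assume "0 < e"
    then obtain n where n: "1 / real (Suc n) < e" using nat_approx_posE by blast
    have "dist (R \<beta> f) (?I f) < e" if \<beta>: "\<beta> \<in> D" "le ({f}, n) \<beta>" for \<beta>
    proof -
      have "f \<in> fst \<beta>" "n \<le> snd \<beta>" using \<beta>(2) by (auto simp: le_def split: prod.splits)
      then have "dist (R \<beta> f) (?I f) \<le> 1 / real (Suc (snd \<beta>))"
        using S(2)[OF \<beta>(1)] by (simp add: R_def dist_norm)
      also have "\<dots> \<le> 1 / real (Suc n)" using \<open>n \<le> snd \<beta>\<close> by (simp add: field_simps)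
      finally show ?thesis using n by simp
    qed
    moreover have "({f}, n) \<in> D" using f by (simp add: D_def)
    ultimately show "\<forall>\<^sub>F \<alpha> in net_filter D le. dist (R \<alpha> f) (?I f) < e"
      unfolding eventually_net_filter[OF dir] by blast
  qed
  show ?thesis using dir RN opnorm lim by blast
qed

end
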